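(* Let $(X,\phi)$ be a calibrated manifold and let $(M,\Gamma)$ be a compact $\phi$-submanifold $M\subset X$ with boundary $\Gamma=\partial M$. Then for each function $f\in C^\infty(X)$ which is $\phi$-pluriharmonic mod $d$ and each point $x\in M$, $$\inf_\Gamma f\ \le\ f(x)\ \le\ \sup_\Gamma f.$$
   Context: A calibrated manifold $(X,\phi)$ is an oriented Riemannian manifold $X$ with a smooth $d$-closed $p$-form $\phi$ of comass one, i.e. $\phi(\xi)\le 1$ for every unit simple $p$-vector $\xi$. $G(\phi)$ denotes the set of $\phi$-planes, i.e. unit simple $p$-vectors $\xi$ with $\phi(\xi)=1$. A $\phi$-submanifold is a smooth oriented $p$-dimensional submanifold whose oriented tangent space at every point is a $\phi$-plane. For $f\in C^\infty(X)$ let $d^\phi f=\nabla f\lrcorner\phi$ (contraction of $\phi$ with the gradient of $f$). A function $f\in C^\infty(X)$ is $\phi$-pluriharmonic mod $d$ if $dd^\phi f=df\wedge\alpha_f+\sigma_f$ for some $(p-1)$-form $\alpha_f$ and some $p$-form $\sigma_f$ with $\sigma_f(\xi)=0$ for all $\xi\in G(\phi)$ (smooth forms on $X$).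
   Formalization: The formal theorem additionally assumes that every connected component of M meets the boundary Γ (so Γ is nonempty if M is); without this the claim fails when M has a closed component on which f is a constant outside the range of f on Γ. *)

theory Defs
  imports "HOL-Analysis.Analysis"
begin

section \<open>Smooth functions between Euclidean spaces\<close>

text \<open>\<open>Ck_on n S f\<close>: \<open>f\<close> is of class C^n on the set \<open>S\<close>, which is meant to be open.\<close>

primrec Ck_on ::
    "nat \<Rightarrow> 'b::euclidean_space set \<Rightarrow> ('b \<Rightarrow> 'c::real_normed_vector) \<Rightarrow> bool" where
  "Ck_on 0 S f \<longleftrightarrow> continuous_on S f"
| "Ck_on (Suc n) S f \<longleftrightarrow>
     (\<forall>x\<in>S. f differentiable (at x)) \<and> (\<forall>v. Ck_on n S (\<lambda>x. frechet_derivative f (at x) v))"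

definition smooth_on ::
    "'b::euclidean_space set \<Rightarrow> ('b \<Rightarrow> 'c::real_normed_vector) \<Rightarrow> bool" where
  "smooth_on S f \<longleftrightarrow> (\<forall>n. Ck_on n S f)"


section \<open>Smooth manifolds\<close>

text \<open>
  The underlying space of the manifold is a whole type \<open>'a\<close>, Hausdorff and second countable; the
  manifold is modelled on the Euclidean space \<open>'e\<close>, so its dimension is \<open>DIM('e)\<close>.  A chart is a
  pair of a domain and a map, of which only the values on the domain matter.
\<close>

type_synonym ('a, 'e) chart = "'a set \<times> ('a \<Rightarrow> 'e)"

abbreviation chart_dom :: "('a, 'e) chart \<Rightarrow> 'a set" where
  "chart_dom c \<equiv> fst c"

abbreviation coord :: "('a, 'e) chart \<Rightarrow> 'a \<Rightarrow> 'e" where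
  "coord c \<equiv> snd c"

abbreviation chart_cod :: "('a, 'e) chart \<Rightarrow> 'e set" where
  "chart_cod c \<equiv> coord c ` chart_dom c"

definition point :: "('a, 'e) chart \<Rightarrow> 'e \<Rightarrow> 'a" where
  "point c = inv_into (chart_dom c) (coord c)"

definition is_chart :: "('a::topological_space, 'e::euclidean_space) chart \<Rightarrow> bool" where
  "is_chart c \<longleftrightarrow> open (chart_dom c) \<and> open (chart_cod c) \<and>
     homeomorphism (chart_dom c) (chart_cod c) (coord c) (point c)"

definition transition :: "('a, 'e) chart \<Rightarrow> ('a, 'e) chart \<Rightarrow> 'e \<Rightarrow> 'e" where
  "transition c d = coord d \<circ> point c"

definition compatible_charts ::
    "('a, 'e::euclidean_space) chart \<Rightarrow> ('a, 'e) chart \<Rightarrow> bool" where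
  "compatible_charts c d \<longleftrightarrow>
     smooth_on (coord c ` (chart_dom c \<inter> chart_dom d)) (transition c d) \<and>
     smooth_on (coord d ` (chart_dom c \<inter> chart_dom d)) (transition d c)"

text \<open>A smooth structure is given by its maximal atlas \<open>A\<close>.\<close>

definition smooth_manifold ::
    "('a::{t2_space, second_countable_topology}, 'e::euclidean_space) chart set \<Rightarrow> bool" where
  "smooth_manifold A \<longleftrightarrow>
     (\<forall>c\<in>A. is_chart c) \<and>
     (\<Union>c\<in>A. chart_dom c) = UNIV \<and>
     (\<forall>c\<in>A. \<forall>d\<in>A. compatible_charts c d) \<and>
     (\<forall>c. is_chart c \<and> (\<forall>d\<in>A. compatible_charts c d) \<longrightarrow> c \<in> A)"

definition smooth_function ::
    "('a, 'e::euclidean_space) chart set \<Rightarrow> ('a \<Rightarrow> real) \<Rightarrow> bool" where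
  "smooth_function A f \<longleftrightarrow> (\<forall>c\<in>A. smooth_on (chart_cod c) (f \<circ> point c))"


section \<open>Tangent vectors\<close>

text \<open>
  A tangent vector at \<open>x\<close> is represented by its component vector in one fixed distinguished chart
  \<open>chart_at A x\<close> around \<open>x\<close>; thus the tangent space at every point is the vector space \<open>'e\<close>.
  \<open>from_chart A c x\<close> turns the components of a vector at \<open>x\<close> with respect to a chart \<open>c\<close> into the
  tangent vector, and \<open>in_chart A c x\<close> computes the components with respect to \<open>c\<close>.
\<close>

definition chart_at :: "('a, 'e) chart set \<Rightarrow> 'a \<Rightarrow> ('a, 'e) chart" where
  "chart_at A x = (SOME c. c \<in> A \<and> x \<in> chart_dom c)"

definition from_chart ::
    "('a, 'e::euclidean_space) chart set \<Rightarrow> ('a, 'e) chart \<Rightarrow> 'a \<Rightarrow> 'e \<Rightarrow> 'e" where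
  "from_chart A c x = frechet_derivative (transition c (chart_at A x)) (at (coord c x))"

definition in_chart ::
    "('a, 'e::euclidean_space) chart set \<Rightarrow> ('a, 'e) chart \<Rightarrow> 'a \<Rightarrow> 'e \<Rightarrow> 'e" where
  "in_chart A c x =
     frechet_derivative (transition (chart_at A x) c) (at (coord (chart_at A x) x))"

definition differential ::
    "('a, 'e::euclidean_space) chart set \<Rightarrow> ('a \<Rightarrow> real) \<Rightarrow> 'a \<Rightarrow> 'e \<Rightarrow> real" where
  "differential A f x =
     frechet_derivative (f \<circ> point (chart_at A x)) (at (coord (chart_at A x) x))"


section \<open>Differential forms\<close>

text \<open>
  A \<open>k\<close>-form assigns to each point an alternating multilinear function of \<open>k\<close> tangent vectors,
  given as a list; its values on lists of another length are irrelevant.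
\<close>

type_synonym ('a, 'e) dform = "'a \<Rightarrow> 'e list \<Rightarrow> real"

definition alternating_form :: "nat \<Rightarrow> ('e::real_vector list \<Rightarrow> real) \<Rightarrow> bool" where
  "alternating_form k \<omega> \<longleftrightarrow>
     (\<forall>vs i. length vs = k \<and> i < k \<longrightarrow> linear (\<lambda>v. \<omega> (vs[i := v]))) \<and>
     (\<forall>vs i j. length vs = k \<and> i < j \<and> j < k \<and> vs ! i = vs ! j \<longrightarrow> \<omega> vs = 0)"

definition local_form ::
    "('a, 'e::euclidean_space) chart set \<Rightarrow> ('a, 'e) chart \<Rightarrow> ('a, 'e) dform \<Rightarrow> ('e, 'e) dform" where
  "local_form A c \<omega> y vs = \<omega> (point c y) (map (from_chart A c (point c y)) vs)"

definition smooth_form ::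
    "('a, 'e::euclidean_space) chart set \<Rightarrow> nat \<Rightarrow> ('a, 'e) dform \<Rightarrow> bool" where
  "smooth_form A k \<omega> \<longleftrightarrow>
     (\<forall>x. alternating_form k (\<omega> x)) \<and>
     (\<forall>c\<in>A. \<forall>vs. length vs = k \<longrightarrow> smooth_on (chart_cod c) (\<lambda>y. local_form A c \<omega> y vs))"

definition omit :: "nat \<Rightarrow> 'b list \<Rightarrow> 'b list" where
  "omit i vs = take i vs @ drop (Suc i) vs"

text \<open>The exterior derivative of a form on an open subset of \<open>'e\<close>.\<close>

definition local_ext_deriv :: "('e::euclidean_space, 'e) dform \<Rightarrow> ('e, 'e) dform" where
  "local_ext_deriv \<omega> y vs =
     (\<Sum>i<length vs. (- 1) ^ i * frechet_derivative (\<lambda>z. \<omega> z (omit i vs)) (at y) (vs ! i))"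

text \<open>\<open>has_ext_deriv A k \<omega> \<eta>\<close>: the \<open>(k + 1)\<close>-form \<open>\<eta>\<close> is \<open>d\<omega>\<close>, for a \<open>k\<close>-form \<open>\<omega>\<close>.\<close>

definition has_ext_deriv ::
    "('a, 'e::euclidean_space) chart set \<Rightarrow> nat \<Rightarrow> ('a, 'e) dform \<Rightarrow> ('a, 'e) dform \<Rightarrow> bool" where
  "has_ext_deriv A k \<omega> \<eta> \<longleftrightarrow>
     (\<forall>c\<in>A. \<forall>y\<in>chart_cod c. \<forall>vs. length vs = Suc k \<longrightarrow>
        local_form A c \<eta> y vs = local_ext_deriv (local_form A c \<omega>) y vs)"

text \<open>The wedge product of a 1-form with a form, at one point.\<close>

definition wedge1 :: "('e \<Rightarrow> real) \<Rightarrow> ('e list \<Rightarrow> real) \<Rightarrow> 'e list \<Rightarrow> real" where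
  "wedge1 \<theta> \<alpha> vs = (\<Sum>i<length vs. (- 1) ^ i * \<theta> (vs ! i) * \<alpha> (omit i vs))"

definition contract :: "'e \<Rightarrow> ('e list \<Rightarrow> real) \<Rightarrow> 'e list \<Rightarrow> real" where
  "contract v \<omega> vs = \<omega> (v # vs)"


section \<open>Calibrated manifolds\<close>

definition riemannian_metric ::
    "('a, 'e::euclidean_space) chart set \<Rightarrow> ('a \<Rightarrow> 'e \<Rightarrow> 'e \<Rightarrow> real) \<Rightarrow> bool" where
  "riemannian_metric A g \<longleftrightarrow>
     (\<forall>x. bilinear (g x) \<and> (\<forall>v w. g x v w = g x w v) \<and> (\<forall>v. v \<noteq> 0 \<longrightarrow> g x v v > 0)) \<and>
     (\<forall>c\<in>A. \<forall>v w. smooth_on (chart_cod c)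
        (\<lambda>y. g (point c y) (from_chart A c (point c y) v) (from_chart A c (point c y) w)))"

text \<open>An orientation is given by a nowhere vanishing form \<open>\<nu>\<close> of top degree.\<close>

definition orientation_form ::
    "('a, 'e::euclidean_space) chart set \<Rightarrow> ('a, 'e) dform \<Rightarrow> bool" where
  "orientation_form A \<nu> \<longleftrightarrow>
     smooth_form A DIM('e) \<nu> \<and> (\<forall>x. \<exists>vs. length vs = DIM('e) \<and> \<nu> x vs \<noteq> 0)"

text \<open>
  A nonzero simple \<open>p\<close>-vector \<open>v\<^sub>1 \<and> \<dots> \<and> v\<^sub>p\<close> is represented by the list of its factors
  \<open>v\<^sub>1, \<dots>, v\<^sub>p\<close>.  The square of its norm is the Gram determinant
  \<open>det (g v\<^sub>i v\<^sub>j)\<close>, and the value of a \<open>p\<close>-form on it is the value of the form on the list.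
\<close>

definition gram_det :: "('e \<Rightarrow> 'e \<Rightarrow> real) \<Rightarrow> 'e list \<Rightarrow> real" where
  "gram_det g vs = (\<Sum>\<pi> | \<pi> permutes {..<length vs}.
     of_int (sign \<pi>) * (\<Prod>i<length vs. g (vs ! i) (vs ! \<pi> i)))"

definition unit_simple :: "('e \<Rightarrow> 'e \<Rightarrow> real) \<Rightarrow> nat \<Rightarrow> 'e list \<Rightarrow> bool" where
  "unit_simple g p \<xi> \<longleftrightarrow> length \<xi> = p \<and> sqrt (gram_det g \<xi>) = 1"

definition calibrated_manifold ::
    "('a::{t2_space, second_countable_topology}, 'e::euclidean_space) chart set \<Rightarrow> ('a, 'e) dform \<Rightarrow>
     ('a \<Rightarrow> 'e \<Rightarrow> 'e \<Rightarrow> real) \<Rightarrow> nat \<Rightarrow> ('a, 'e) dform \<Rightarrow> bool" where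
  "calibrated_manifold A \<nu> g p \<phi> \<longleftrightarrow>
     smooth_manifold A \<and> orientation_form A \<nu> \<and> riemannian_metric A g \<and>
     1 \<le> p \<and> smooth_form A p \<phi> \<and> has_ext_deriv A p \<phi> (\<lambda>x vs. 0) \<and>
     (\<forall>x \<xi>. unit_simple (g x) p \<xi> \<longrightarrow> \<phi> x \<xi> \<le> 1)"

text \<open>The fibre of \<open>G(\<phi>)\<close> at \<open>x\<close>.\<close>

definition phi_planes ::
    "('a \<Rightarrow> 'e \<Rightarrow> 'e \<Rightarrow> real) \<Rightarrow> nat \<Rightarrow> ('a, 'e) dform \<Rightarrow> 'a \<Rightarrow> 'e list set" where
  "phi_planes g p \<phi> x = {\<xi>. unit_simple (g x) p \<xi> \<and> \<phi> x \<xi> = 1}"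


section \<open>Submanifolds with boundary\<close>

text \<open>
  Slice charts: in the chart \<open>c\<close>, the set \<open>M\<close> is an open piece of a \<open>p\<close>-dimensional linear subspace
  \<open>P\<close>, respectively of the closed half-space of \<open>P\<close> determined by a nonzero vector \<open>a \<in> P\<close>.
\<close>

definition slice_chart ::
    "('a, 'e::euclidean_space) chart set \<Rightarrow> nat \<Rightarrow> 'a set \<Rightarrow> ('a, 'e) chart \<Rightarrow> 'e set \<Rightarrow> bool" where
  "slice_chart A p M c P \<longleftrightarrow> c \<in> A \<and> subspace P \<and> dim P = p \<and>
     coord c ` (chart_dom c \<inter> M) = chart_cod c \<inter> P"

definition half_slice_chart ::
    "('a, 'e::euclidean_space) chart set \<Rightarrow> nat \<Rightarrow> 'a set \<Rightarrow> ('a, 'e) chart \<Rightarrow> 'e set \<Rightarrow> 'e \<Rightarrow> bool" where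
  "half_slice_chart A p M c P a \<longleftrightarrow> c \<in> A \<and> subspace P \<and> dim P = p \<and> a \<in> P \<and> a \<noteq> 0 \<and>
     coord c ` (chart_dom c \<inter> M) = chart_cod c \<inter> {y \<in> P. 0 \<le> a \<bullet> y}"

definition manifold_boundary ::
    "('a, 'e::euclidean_space) chart set \<Rightarrow> nat \<Rightarrow> 'a set \<Rightarrow> 'a set" where
  "manifold_boundary A p M =
     {x \<in> M. \<exists>c P a. half_slice_chart A p M c P a \<and> x \<in> chart_dom c \<and> a \<bullet> coord c x = 0}"

definition submanifold_with_boundary ::
    "('a, 'e::euclidean_space) chart set \<Rightarrow> nat \<Rightarrow> 'a set \<Rightarrow> 'a set \<Rightarrow> bool" where
  "submanifold_with_boundary A p M \<Gamma> \<longleftrightarrow> \<Gamma> = manifold_boundary A p M \<and>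
     (\<forall>x\<in>M - \<Gamma>. \<exists>c P. slice_chart A p M c P \<and> x \<in> chart_dom c)"

text \<open>The tangent space of \<open>M\<close> at \<open>x \<in> M\<close>; at boundary points this is the full \<open>p\<close>-dimensional space.\<close>

definition tangent_subspace ::
    "('a, 'e::euclidean_space) chart set \<Rightarrow> nat \<Rightarrow> 'a set \<Rightarrow> 'a \<Rightarrow> 'e set" where
  "tangent_subspace A p M x =
     {v. \<forall>c P. x \<in> chart_dom c \<and> (slice_chart A p M c P \<or> (\<exists>a. half_slice_chart A p M c P a)) \<longrightarrow>
        in_chart A c x v \<in> P}"

text \<open>
  An orientation of \<open>M\<close> is a continuous field \<open>\<tau>\<close> of unit simple \<open>p\<close>-vectors tangent to \<open>M\<close>.  Only
  the \<open>p\<close>-vector represented by the list \<open>\<tau> x\<close> has to vary continuously, not its factors (there need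
  not be a continuous global frame); hence continuity is expressed by evaluating \<open>p\<close>-forms.
\<close>

definition submanifold_orientation ::
    "('a::topological_space, 'e::euclidean_space) chart set \<Rightarrow> ('a \<Rightarrow> 'e \<Rightarrow> 'e \<Rightarrow> real) \<Rightarrow> nat \<Rightarrow>
     'a set \<Rightarrow> ('a \<Rightarrow> 'e list) \<Rightarrow> bool" where
  "submanifold_orientation A g p M \<tau> \<longleftrightarrow>
     (\<forall>x\<in>M. unit_simple (g x) p (\<tau> x) \<and> set (\<tau> x) \<subseteq> tangent_subspace A p M x) \<and>
     (\<forall>\<omega>. smooth_form A p \<omega> \<longrightarrow> continuous_on M (\<lambda>x. \<omega> x (\<tau> x)))"

definition phi_submanifold ::
    "('a::topological_space, 'e::euclidean_space) chart set \<Rightarrow> ('a \<Rightarrow> 'e \<Rightarrow> 'e \<Rightarrow> real) \<Rightarrow> nat \<Rightarrow>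
     ('a, 'e) dform \<Rightarrow> 'a set \<Rightarrow> 'a set \<Rightarrow> ('a \<Rightarrow> 'e list) \<Rightarrow> bool" where
  "phi_submanifold A g p \<phi> M \<Gamma> \<tau> \<longleftrightarrow>
     submanifold_with_boundary A p M \<Gamma> \<and> submanifold_orientation A g p M \<tau> \<and>
     (\<forall>x\<in>M. \<tau> x \<in> phi_planes g p \<phi> x)"


section \<open>Pluriharmonic functions\<close>

definition gradient ::
    "('a, 'e::euclidean_space) chart set \<Rightarrow> ('a \<Rightarrow> 'e \<Rightarrow> 'e \<Rightarrow> real) \<Rightarrow> ('a \<Rightarrow> real) \<Rightarrow> 'a \<Rightarrow> 'e" where
  "gradient A g f x = (THE v. \<forall>w. g x v w = differential A f x w)"

definition d_phi ::
    "('a, 'e::euclidean_space) chart set \<Rightarrow> ('a \<Rightarrow> 'e \<Rightarrow> 'e \<Rightarrow> real) \<Rightarrow> ('a, 'e) dform \<Rightarrow>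
     ('a \<Rightarrow> real) \<Rightarrow> ('a, 'e) dform" where
  "d_phi A g \<phi> f x = contract (gradient A g f x) (\<phi> x)"

definition pluriharmonic_mod_d ::
    "('a, 'e::euclidean_space) chart set \<Rightarrow> ('a \<Rightarrow> 'e \<Rightarrow> 'e \<Rightarrow> real) \<Rightarrow> nat \<Rightarrow> ('a, 'e) dform \<Rightarrow>
     ('a \<Rightarrow> real) \<Rightarrow> bool" where
  "pluriharmonic_mod_d A g p \<phi> f \<longleftrightarrow>
     smooth_function A f \<and>
     (\<exists>\<alpha> \<sigma>. smooth_form A (p - 1) \<alpha> \<and> smooth_form A p \<sigma> \<and>
        (\<forall>x. \<forall>\<xi>\<in>phi_planes g p \<phi> x. \<sigma> x \<xi> = 0) \<and>
        has_ext_deriv A (p - 1) (d_phi A g \<phi> f)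
          (\<lambda>x vs. wedge1 (differential A f x) (\<alpha> x) vs + \<sigma> x vs))"

end

theory Submission
  imports Defs
begin

text \<open>
  Restricted to \<open>M\<close>, the function \<open>f\<close> solves a second order elliptic equation without term of order
  zero, so the strong maximum principle applies to it.

  The equation comes from the first cousin principle: since \<open>\<phi>\<close> has comass one, a \<open>\<phi>\<close>-plane
  \<open>\<xi>\<^sub>1 \<and> \<dots> \<and> \<xi>\<^sub>p\<close> maximises \<open>\<phi>\<close> among unit simple \<open>p\<close>-vectors, and the vanishing of the first
  variation says that \<open>\<phi>\<close> vanishes when one factor \<open>\<xi>\<^sub>i\<close> is replaced by a vector normal to the plane.
  Hence only the tangential part of the gradient contributes to \<open>(\<nabla>f \<lrcorner> \<phi>)|\<^sub>M\<close>: this form is the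
  Hodge dual of \<open>d(f|\<^sub>M)\<close>, and its exterior derivative is the Laplacian of \<open>f|\<^sub>M\<close> times the volume
  form. On the other hand \<open>dd\<^sup>\<phi> f|\<^sub>M = df \<and> \<alpha>|\<^sub>M\<close>, because \<open>\<sigma>\<close> vanishes on the tangent planes of
  \<open>M\<close>. So the Laplacian of \<open>f|\<^sub>M\<close> is a linear expression in its first derivatives.

  In a slice chart \<open>M\<close> is an open piece of a linear subspace \<open>P\<close>. There the equation is used only
  through the inequality \<open>\<bar>\<Sum>\<^sub>q D\<^sup>2f(q, q)\<bar> \<le> K \<bar>df|\<^sub>P\<bar>\<close>, where \<open>q\<close> runs over a basis of \<open>P\<close> that
  is orthonormal for the metric at the point considered, and \<open>K\<close> is locally uniform
  (\<open>elliptic_inequality\<close>). The inequality is insensitive to the sign of \<open>f\<close> and is all that Hopf's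
  barrier argument needs (\<open>strong_maximum_principle\<close>).

  Globally, let \<open>C\<close> be the component of \<open>M\<close> that contains \<open>x\<close>. If the maximum of \<open>f\<close> over \<open>C\<close> were
  not attained on \<open>\<Gamma>\<close>, the set where it is attained would be open and closed in \<open>C\<close>, hence equal to
  \<open>C\<close>, although \<open>C\<close> meets \<open>\<Gamma>\<close> (\<open>component_maximum_on_boundary\<close>). The lower bound is the same
  statement for \<open>- f\<close>.\<close>

section \<open>Alternating forms\<close>

lemma alternating_form_linear:
  "alternating_form k \<omega> \<Longrightarrow> length vs = k \<Longrightarrow> i < k \<Longrightarrow> linear (\<lambda>v. \<omega> (vs[i := v]))"
  by (simp add: alternating_form_def)

lemma alternating_form_repeat:
  "alternating_form k \<omega> \<Longrightarrow> length vs = k \<Longrightarrow> i < k \<Longrightarrow> j < k \<Longrightarrow> i \<noteq> j \<Longrightarrow> vs ! i = vs ! j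
    \<Longrightarrow> \<omega> vs = 0"
  unfolding alternating_form_def by (metis linorder_neqE_nat)

lemma alternating_form_swap:
  assumes alt: "alternating_form k \<omega>" and len: "length vs = k"
    and ij: "i < k" "j < k" "i \<noteq> j"
  shows "\<omega> (vs[i := a, j := b]) = - \<omega> (vs[i := b, j := a])"
proof -
  define B where "B x y = \<omega> (vs[i := x, j := y])" for x y
  have B2: "B x (y + z) = B x y + B x z" for x y z
    using linear_add[OF alternating_form_linear[OF alt, of "vs[i := x]" j]] len ij
    by (simp add: B_def)
  have B1: "B (y + z) x = B y x + B z x" for x y z
    using linear_add[OF alternating_form_linear[OF alt, of "vs[j := x]" i]] len ij
    by (simp add: B_def list_update_swap)
  have B0: "B x x = 0" for x
    unfolding B_def using alternating_form_repeat[OF alt, of "vs[i := x, j := x]" i j] len ij by simp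
  have "B (a + b) (a + b) = B a a + B a b + (B b a + B b b)"
    by (simp only: B1 B2)
  then have "B a b = - B b a" using B0 by simp
  then show ?thesis by (simp add: B_def)
qed

lemma alternating_form_move_to_front:
  assumes alt: "alternating_form k \<omega>"
  shows "length (as @ N # us @ ws) = k \<Longrightarrow>
    \<omega> (as @ N # us @ ws) = (-1) ^ length us * \<omega> (as @ us @ N # ws)"
proof (induction us arbitrary: as)
  case (Cons u us)
  have "\<omega> (as @ N # u # us @ ws) = - \<omega> (as @ u # N # us @ ws)"
    using alternating_form_swap[OF alt, of "as @ N # u # us @ ws" "length as" "Suc (length as)" N u]
      Cons.prems by (simp add: list_update_append)
  then show ?case using Cons.IH[of "as @ [u]"] Cons.prems by simp
qed simp

lemma alternating_form_Cons_omit: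
  assumes alt: "alternating_form k \<omega>" and len: "length vs = k" and i: "i < k"
  shows "(-1) ^ i * \<omega> (N # omit i vs) = \<omega> (vs[i := N])"
proof -
  have "\<omega> ([] @ N # take i vs @ drop (Suc i) vs)
      = (-1) ^ length (take i vs) * \<omega> ([] @ take i vs @ N # drop (Suc i) vs)"
    by (rule alternating_form_move_to_front[OF alt]) (use len i in auto)
  then have "\<omega> (N # omit i vs) = (-1) ^ i * \<omega> (vs[i := N])"
    using len i by (simp add: omit_def upd_conv_take_nth_drop)
  then show ?thesis by (simp add: power_mult_distrib[symmetric] flip: mult.assoc)
qed

lemma alternating_form_pullback:
  assumes alt: "alternating_form k \<omega>" and S: "linear S"
  shows "alternating_form k (\<lambda>vs. \<omega> (map S vs))"
proof -
  have "linear (\<lambda>v. \<omega> (map S (vs[i := v])))" if "length vs = k" "i < k" for vs i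
    using linear_compose[OF S alternating_form_linear[OF alt, of "map S vs" i]] that
    by (simp add: map_update o_def)
  moreover have "\<omega> (map S vs) = 0"
    if "length vs = k" "i < j" "j < k" "vs ! i = vs ! j" for vs i j
    using alternating_form_repeat[OF alt, of "map S vs" i j] that by simp
  ultimately show ?thesis unfolding alternating_form_def by blast
qed

lemma alternating_form_permute_zero:
  assumes alt: "alternating_form k \<omega>" and pi: "\<pi> permutes {..<k}"
  shows "length vs = k \<Longrightarrow> \<omega> vs = 0 \<Longrightarrow> \<omega> (permute_list \<pi> vs) = 0"
  using pi finite_lessThan
proof (induction \<pi> arbitrary: vs rule: permutes_induct)
  case (swap a b \<pi>)
  then have ab: "a < k" "b < k" by auto
  have "permute_list (Transposition.transpose a b) vs = vs[a := vs ! b, b := vs ! a]"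
    using swap ab
    by (intro nth_equalityI)
      (simp_all add: permute_list_def Transposition.transpose_def nth_list_update)
  moreover have "\<omega> (vs[a := vs ! b, b := vs ! a]) = - \<omega> (vs[a := vs ! a, b := vs ! b])"
    using alternating_form_swap[OF alt, of vs a b] swap.prems ab swap.hyps by simp
  ultimately have "\<omega> (permute_list (Transposition.transpose a b) vs) = 0"
    using swap.prems by simp
  then have "\<omega> (permute_list \<pi> (permute_list (Transposition.transpose a b) vs)) = 0"
    using swap.IH[of "permute_list (Transposition.transpose a b) vs"] swap.prems by simp
  moreover have "\<pi> permutes {..<length vs}" using swap.hyps swap.prems by simp
  ultimately show ?case using permute_list_compose[of \<pi> vs "Transposition.transpose a b"] by metis
qed auto

text \<open>
  Multilinearity: the entries are moved from \<open>S\<close> to its span one at a time, which is the induction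
  on \<open>n\<close> below.\<close>

lemma alternating_form_zero_on_span:
  assumes alt: "alternating_form k \<omega>"
    and zero: "\<And>vs. length vs = k \<Longrightarrow> set vs \<subseteq> S \<Longrightarrow> \<omega> vs = 0"
    and len: "length vs = k" and vs: "set vs \<subseteq> span S"
  shows "\<omega> vs = 0"
proof -
  have "\<omega> vs = 0" if "n \<le> k" "length vs = k"
    "\<And>i. i < k \<Longrightarrow> vs ! i \<in> (if i < n then span S else S)" for n vs
    using that
  proof (induction n arbitrary: vs)
    case 0
    then show ?case using zero[of vs] by (metis in_set_conv_nth not_less_zero subsetI)
  next
    case (Suc n)
    have lin: "linear (\<lambda>v. \<omega> (vs[n := v]))"
      using alternating_form_linear[OF alt] Suc.prems by simp
    have "\<omega> (vs[n := v]) = 0" if "v \<in> S" for v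
    proof (rule Suc.IH)
      fix i assume "i < k"
      then show "vs[n := v] ! i \<in> (if i < n then span S else S)"
        using Suc.prems(2) Suc.prems(3)[of i] that by (cases "i = n") (auto simp: less_Suc_eq)
    qed (use Suc.prems in auto)
    then have "\<omega> (vs[n := v]) = 0" if "v \<in> span S" for v
      using linear_eq_0_on_span[OF lin _ that] by blast
    from this[of "vs ! n"] show ?case using Suc.prems(1) Suc.prems(3)[of n] by simp
  qed
  from this[of k vs] show ?thesis using len vs by (auto simp: subset_iff)
qed

text \<open>
  On the span of \<open>k\<close> vectors an alternating \<open>k\<close>-form is a multiple of a determinant, so it vanishes
  there as soon as it vanishes on these vectors.\<close>

lemma alternating_form_zero_on_top:
  assumes alt: "alternating_form k \<omega>" and \<xi>: "length \<xi> = k" "\<omega> \<xi> = 0"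
    and vs: "length vs = k" "set vs \<subseteq> span (set \<xi>)"
  shows "\<omega> vs = 0"
proof (rule alternating_form_zero_on_span[OF alt _ vs])
  fix ws assume ws: "length ws = k" "set ws \<subseteq> set \<xi>"
  show "\<omega> ws = 0"
  proof (cases "distinct ws")
    case True
    then have "card (set ws) = k" using ws by (simp add: distinct_card)
    moreover have "card (set \<xi>) \<le> k" using \<xi> card_length by blast
    ultimately have "set ws = set \<xi>" and "card (set \<xi>) = length \<xi>"
      using ws \<xi> by (auto simp: card_seteq dest: card_mono[OF finite_set])
    then have "distinct \<xi>" "set ws = set \<xi>" by (auto intro: card_distinct)
    then have "mset ws = mset \<xi>" using True set_eq_iff_mset_eq_distinct by blast
    then obtain \<pi> where "\<pi> permutes {..<length \<xi>}" "permute_list \<pi> \<xi> = ws"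
      by (metis mset_eq_permutation)
    then show ?thesis using alternating_form_permute_zero[OF alt, of \<pi> \<xi>] \<xi> by auto
  next
    case False
    then obtain i j where "i < length ws" "j < length ws" "i \<noteq> j" "ws ! i = ws ! j"
      by (auto simp: distinct_conv_nth)
    then show ?thesis using alternating_form_repeat[OF alt] ws by blast
  qed
qed

text \<open>
  An alternating form vanishes on linearly dependent vectors, so the factors of a simple vector on
  which a form does not vanish are a basis of any space of the right dimension containing them.\<close>

lemma alternating_form_nonzero_spans:
  fixes P :: "'e::euclidean_space set"
  assumes alt: "alternating_form k \<omega>" and \<xi>: "length \<xi> = k" "\<omega> \<xi> \<noteq> 0"
    and P: "subspace P" "dim P = k" "set \<xi> \<subseteq> P"
  shows "span (set \<xi>) = P"
proof -
  have dist: "distinct \<xi>"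
    unfolding distinct_conv_nth using alternating_form_repeat[OF alt] \<xi> by blast
  have "independent (set \<xi>)"
  proof (rule ccontr)
    assume "\<not> independent (set \<xi>)"
    then obtain v where v: "v \<in> set \<xi>" "v \<in> span (set \<xi> - {v})"
      unfolding dependent_def by blast
    then obtain i where i: "i < k" "\<xi> ! i = v" using \<xi> by (metis in_set_conv_nth)
    have lin: "linear (\<lambda>w. \<omega> (\<xi>[i := w]))" by (rule alternating_form_linear[OF alt \<xi>(1) i(1)])
    have "\<omega> (\<xi>[i := w]) = 0" if w: "w \<in> set \<xi> - {v}" for w
    proof -
      obtain j where "j < k" "\<xi> ! j = w" using w \<xi> by (metis DiffD1 in_set_conv_nth)
      then show ?thesis using alternating_form_repeat[OF alt, of "\<xi>[i := w]" i j] w i \<xi> by auto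
    qed
    then have "\<omega> (\<xi>[i := v]) = 0" using linear_eq_0_on_span[OF lin _ v(2)] by blast
    then show False using i \<xi> by auto
  qed
  moreover have "card (set \<xi>) = dim P" using dist \<xi> P by (simp add: distinct_card)
  ultimately have "P \<subseteq> span (set \<xi>)"
    using card_ge_dim_independent[of "set \<xi>" P] P by simp
  then show ?thesis using P by (simp add: span_minimal subset_antisym)
qed

text \<open>
  This is the derivative at \<open>t = 0\<close> of the pullback of \<open>\<omega>\<close> by \<open>v \<mapsto> v + t \<theta>(v) N\<close>, that is
  \<open>\<theta> \<and> (N \<lrcorner> \<omega>)\<close>. It carries the first cousin principle over from one basis of a plane to another.\<close>

lemma alternating_form_derivation:
  assumes alt: "alternating_form k \<omega>" and \<theta>: "linear \<theta>"
  shows "alternating_form k (\<lambda>vs. \<Sum>i<k. \<theta> (vs ! i) * \<omega> (vs[i := N]))"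
proof -
  have "linear (\<lambda>v. \<Sum>i<k. \<theta> (vs[j := v] ! i) * \<omega> (vs[j := v, i := N]))"
    if "length vs = k" "j < k" for vs j
  proof (rule linear_compose_sum, intro ballI)
    fix i assume "i \<in> {..<k}"
    then have i: "i < k" by simp
    show "linear (\<lambda>v. \<theta> (vs[j := v] ! i) * \<omega> (vs[j := v, i := N]))"
    proof (cases "i = j")
      case True
      have "linear (\<lambda>v. \<theta> v * \<omega> (vs[j := N]))"
        using linear_compose[OF \<theta>, of "\<lambda>r. r * \<omega> (vs[j := N])"]
        by (simp add: o_def linear_times linear_iff algebra_simps)
      then show ?thesis using True that by simp
    next
      case False
      have "linear (\<lambda>v. \<theta> (vs ! i) * \<omega> (vs[i := N, j := v]))"
        using linear_compose[OF alternating_form_linear[OF alt, of "vs[i := N]" j]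
            linear_times[of "\<theta> (vs ! i)"]] that by (simp add: o_def)
      then show ?thesis using False that by (simp add: list_update_swap)
    qed
  qed
  moreover have "(\<Sum>i<k. \<theta> (vs ! i) * \<omega> (vs[i := N])) = 0"
    if "length vs = k" "a < b" "b < k" "vs ! a = vs ! b" for vs a b
  proof -
    have "\<omega> (vs[i := N]) = 0" if "i < k" "i \<noteq> a" "i \<noteq> b" for i
      using alternating_form_repeat[OF alt, of "vs[i := N]" a b] that
        \<open>length vs = k\<close> \<open>a < b\<close> \<open>b < k\<close> \<open>vs ! a = vs ! b\<close> by simp
    then have "(\<Sum>i<k. \<theta> (vs ! i) * \<omega> (vs[i := N]))
        = (\<Sum>i\<in>{a, b}. \<theta> (vs ! i) * \<omega> (vs[i := N]))"
      by (intro sum.mono_neutral_right) (use that in auto)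
    also have "\<dots> = \<theta> (vs ! a) * (\<omega> (vs[a := N]) + \<omega> (vs[b := N]))"
      using that by (simp add: algebra_simps)
    also have "\<omega> (vs[a := N]) = - \<omega> (vs[b := N])"
      using alternating_form_swap[OF alt that(1), of a b N "vs ! a"] that
      by (metis list_update_id list_update_swap order_less_trans less_irrefl_nat)
    finally show ?thesis by simp
  qed
  ultimately show ?thesis unfolding alternating_form_def by blast
qed

section \<open>The first cousin principle\<close>

text \<open>
  A permutation that fixes \<open>i\<close> contributes the factor \<open>g (\<xi>\<^sub>i + t N) (\<xi>\<^sub>i + t N)\<close>, which has no
  linear term in \<open>t\<close>; for every other permutation the perturbed vector is paired only with some
  \<open>\<xi>\<^sub>j\<close>, \<open>j \<noteq> i\<close>, where \<open>N\<close> is not seen. So the norm is constant to first order.\<close>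

lemma gram_det_perturb_orthogonal:
  assumes bil: "bilinear g" and sym: "\<And>v w. g v w = g w v"
    and i: "i < length \<xi>" and N: "\<And>v. v \<in> set \<xi> \<Longrightarrow> g N v = 0"
  shows "\<exists>c. \<forall>t. gram_det g (\<xi>[i := \<xi> ! i + t *\<^sub>R N]) = gram_det g \<xi> + c * t\<^sup>2"
proof -
  define n where "n = length \<xi>"
  define c where "c \<pi> = (if \<pi> i = i then of_int (sign \<pi>) *
      (g N N * (\<Prod>k\<in>{..<n} - {i}. g (\<xi> ! k) (\<xi> ! \<pi> k))) else 0)" for \<pi> :: "nat \<Rightarrow> nat"
  have "gram_det g (\<xi>[i := \<xi> ! i + t *\<^sub>R N])
      = gram_det g \<xi> + (\<Sum>\<pi> | \<pi> permutes {..<n}. c \<pi>) * t\<^sup>2" for t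
  proof -
    let ?\<xi> = "\<xi>[i := \<xi> ! i + t *\<^sub>R N]"
    have N': "g N (\<xi> ! k) = 0" "g (\<xi> ! k) N = 0" if "k < n" for k
      using N[of "\<xi> ! k"] sym that by (auto simp: n_def)
    have nth: "?\<xi> ! k = \<xi> ! k" if "k \<noteq> i" for k using that by simp
    have nthi: "?\<xi> ! i = \<xi> ! i + t *\<^sub>R N" using i by simp
    have "of_int (sign \<pi>) * (\<Prod>k<n. g (?\<xi> ! k) (?\<xi> ! \<pi> k))
        = of_int (sign \<pi>) * (\<Prod>k<n. g (\<xi> ! k) (\<xi> ! \<pi> k)) + c \<pi> * t\<^sup>2"
      if \<pi>: "\<pi> permutes {..<n}" for \<pi>
    proof (cases "\<pi> i = i")
      case True
      have ii: "i \<in> {..<n}" using i n_def by simp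
      have "g (?\<xi> ! k) (?\<xi> ! \<pi> k) = g (\<xi> ! k) (\<xi> ! \<pi> k)" if "k \<in> {..<n} - {i}" for k
      proof -
        have "\<pi> k \<noteq> i" using True \<pi> that by (metis DiffE insertI1 permutes_inv_eq)
        then show ?thesis using that nth by auto
      qed
      then have "(\<Prod>k\<in>{..<n} - {i}. g (?\<xi> ! k) (?\<xi> ! \<pi> k)) = (\<Prod>k\<in>{..<n} - {i}. g (\<xi> ! k) (\<xi> ! \<pi> k))"
        by (intro prod.cong) auto
      moreover have "g (?\<xi> ! i) (?\<xi> ! \<pi> i) = g (\<xi> ! i) (\<xi> ! i) + t\<^sup>2 * g N N"
        unfolding True nthi
        using i N'[of i] by (simp add: n_def bilinear_ladd[OF bil] bilinear_radd[OF bil]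
            bilinear_lmul[OF bil] bilinear_rmul[OF bil] power2_eq_square)
      ultimately show ?thesis using True
        by (simp add: prod.remove[OF finite_lessThan ii] c_def algebra_simps)
    next
      case False
      have "g (?\<xi> ! k) (?\<xi> ! \<pi> k) = g (\<xi> ! k) (\<xi> ! \<pi> k)" if "k \<in> {..<n}" for k
      proof -
        have \<pi>k: "\<pi> k < n" using \<pi> that permutes_in_image by fastforce
        have "k = i \<Longrightarrow> \<pi> k \<noteq> i" using False by simp
        then consider "k = i" "\<pi> k \<noteq> i" | "k \<noteq> i" "\<pi> k = i" | "k \<noteq> i" "\<pi> k \<noteq> i" by argo
        then show ?thesis
        proof cases
          case 1
          then show ?thesis using N'[OF \<pi>k] i
            by (simp add: bilinear_ladd[OF bil] bilinear_lmul[OF bil])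
        next
          case 2
          then show ?thesis using N'[of k] that i
            by (simp add: bilinear_radd[OF bil] bilinear_rmul[OF bil])
        qed simp
      qed
      then show ?thesis using False by (simp add: c_def)
    qed
    then show ?thesis
      by (simp add: gram_det_def sum.distrib sum_distrib_right n_def)
  qed
  then show ?thesis by blast
qed

lemma gram_det_scale:
  assumes bil: "bilinear g" and i: "i < length \<xi>"
  shows "gram_det g (\<xi>[i := s *\<^sub>R (\<xi> ! i)]) = s\<^sup>2 * gram_det g \<xi>"
proof -
  define n where "n = length \<xi>"
  define a where "a k = (if k = i then s else 1)" for k
  have nth: "\<xi>[i := s *\<^sub>R (\<xi> ! i)] ! k = a k *\<^sub>R (\<xi> ! k)" for k
    using i by (auto simp: a_def nth_list_update)
  have "(\<Prod>k<n. g (a k *\<^sub>R \<xi> ! k) (a (\<pi> k) *\<^sub>R \<xi> ! \<pi> k)) = s\<^sup>2 * (\<Prod>k<n. g (\<xi> ! k) (\<xi> ! \<pi> k))"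
    if \<pi>: "\<pi> permutes {..<n}" for \<pi>
  proof -
    have a: "(\<Prod>k<n. a k) = s" using i by (simp add: a_def n_def)
    moreover have "(\<Prod>k<n. a (\<pi> k)) = s"
      using prod.permute[OF \<pi>, of a] a by (simp add: o_def)
    ultimately show ?thesis
      by (simp add: bilinear_lmul[OF bil] bilinear_rmul[OF bil] prod.distrib power2_eq_square)
  qed
  then show ?thesis
    by (simp add: gram_det_def nth n_def sum_distrib_left algebra_simps)
qed

text \<open>
  A calibrated plane maximises \<open>\<omega>\<close> among the unit simple \<open>p\<close>-vectors. Turning the factor \<open>\<xi>\<^sub>i\<close> in the
  direction \<open>N\<close> changes the value of \<open>\<omega>\<close> by \<open>t \<omega>(\<xi>[i := N])\<close> but the norm only by \<open>O(t\<^sup>2)\<close>, so the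
  coefficient of \<open>t\<close> must vanish.\<close>

lemma first_cousin_principle:
  assumes bil: "bilinear g" and sym: "\<And>v w. g v w = g w v"
    and alt: "alternating_form p \<omega>"
    and comass: "\<And>\<zeta>. unit_simple g p \<zeta> \<Longrightarrow> \<omega> \<zeta> \<le> 1"
    and \<xi>: "unit_simple g p \<xi>" "\<omega> \<xi> = 1"
    and i: "i < p" and N: "\<And>v. v \<in> set \<xi> \<Longrightarrow> g N v = 0"
  shows "\<omega> (\<xi>[i := N]) = 0"
proof (rule ccontr)
  define a where "a = \<omega> (\<xi>[i := N])"
  assume "\<omega> (\<xi>[i := N]) \<noteq> 0"
  then have a: "a\<^sup>2 > 0" by (simp add: a_def)
  have len: "length \<xi> = p" and gram: "gram_det g \<xi> = 1"
    using \<xi> by (auto simp: unit_simple_def)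
  have lin: "linear (\<lambda>v. \<omega> (\<xi>[i := v]))" by (rule alternating_form_linear[OF alt len i])
  obtain c where c: "\<And>t. gram_det g (\<xi>[i := \<xi> ! i + t *\<^sub>R N]) = 1 + c * t\<^sup>2"
    using gram_det_perturb_orthogonal[OF bil sym, of i \<xi> N] N i len gram by auto
  have bound: "1 + t * a \<le> sqrt (1 + c * t\<^sup>2)" if q: "1 + c * t\<^sup>2 > 0" for t
  proof -
    define s where "s = 1 / sqrt (1 + c * t\<^sup>2)"
    have s: "s > 0" "s\<^sup>2 * (1 + c * t\<^sup>2) = 1"
      using q by (auto simp: s_def power_divide)
    let ?v = "\<xi> ! i + t *\<^sub>R N"
    have "gram_det g (\<xi>[i := s *\<^sub>R ?v]) = 1"
      using gram_det_scale[OF bil, of i "\<xi>[i := ?v]" s] i len c[of t] s by simp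
    then have "unit_simple g p (\<xi>[i := s *\<^sub>R ?v])" using len by (simp add: unit_simple_def)
    then have "\<omega> (\<xi>[i := s *\<^sub>R ?v]) \<le> 1" by (rule comass)
    moreover have "\<omega> (\<xi>[i := s *\<^sub>R ?v]) = s * (1 + t * a)"
      using \<xi>(2) by (simp add: linear_scale[OF lin] linear_add[OF lin] a_def)
    ultimately show ?thesis using q by (simp add: s_def divide_le_eq)
  qed
  \<comment> \<open>\<open>t = s a\<close> has the sign of \<open>a\<close>, and \<open>s\<close> is so small that the gain \<open>2 s a\<^sup>2\<close> beats \<open>c s\<^sup>2 a\<^sup>2\<close> and
    that \<open>1 + c t\<^sup>2\<close> stays positive\<close>
  define s where "s = 1 / (1 + \<bar>c\<bar> + \<bar>c\<bar> * a\<^sup>2)"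
  define D where "D = 1 + \<bar>c\<bar> + \<bar>c\<bar> * a\<^sup>2"
  have "D \<ge> 1" by (simp add: D_def)
  then have "0 < s" "s \<le> 1" "s * D = 1" by (simp_all add: s_def flip: D_def)
  then have s: "0 < s" "s \<le> 1" "s * (1 + \<bar>c\<bar> + \<bar>c\<bar> * a\<^sup>2) = 1" by (simp_all add: D_def)
  then have s': "s * \<bar>c\<bar> \<le> 1" "s * (\<bar>c\<bar> * a\<^sup>2) < 1"
  proof -
    have "0 \<le> s * \<bar>c\<bar>" "0 \<le> s * (\<bar>c\<bar> * a\<^sup>2)" using s(1) by simp_all
    moreover have "s + s * \<bar>c\<bar> + s * (\<bar>c\<bar> * a\<^sup>2) = 1" using s(3) by (simp add: distrib_left)
    ultimately show "s * \<bar>c\<bar> \<le> 1" "s * (\<bar>c\<bar> * a\<^sup>2) < 1"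
      using s(1) by linarith+
  qed
  have "s * (s * (\<bar>c\<bar> * a\<^sup>2)) \<le> 1 * (s * (\<bar>c\<bar> * a\<^sup>2))"
    by (rule mult_right_mono) (use s in auto)
  then have "s * (s * (\<bar>c\<bar> * a\<^sup>2)) < 1" using s'(2) by linarith
  then have "\<bar>c * (s * a)\<^sup>2\<bar> < 1"
    using s(1) by (simp add: abs_mult power_mult_distrib power2_eq_square[of s] mult_ac)
  then have q: "1 + c * (s * a)\<^sup>2 > 0" by linarith
  have "1 + s * a\<^sup>2 \<le> sqrt (1 + c * (s * a)\<^sup>2)"
    using bound[OF q] by (simp add: power2_eq_square mult_ac)
  moreover have "0 \<le> 1 + s * a\<^sup>2" using s a by simp
  ultimately have "(1 + s * a\<^sup>2)\<^sup>2 \<le> 1 + c * (s * a)\<^sup>2"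
    using q by (metis less_imp_le power2_le_iff_abs_le power_mono real_sqrt_pow2)
  then have "2 * (s * a\<^sup>2) + (s * a\<^sup>2)\<^sup>2 \<le> c * (s * a)\<^sup>2" by (simp add: power2_sum)
  then have "2 * (s * a\<^sup>2) \<le> c * (s * a)\<^sup>2" using zero_le_power2[of "s * a\<^sup>2"] by linarith
  also have "c * (s * a)\<^sup>2 = (s * c) * (s * a\<^sup>2)" by (simp add: power2_eq_square)
  also have "\<dots> \<le> 1 * (s * a\<^sup>2)"
    using s s' a by (intro mult_right_mono) (auto intro: order_trans[of _ "s * \<bar>c\<bar>"] mult_left_mono)
  finally show False using s a by simp
qed

text \<open>
  The first cousin principle for an arbitrary basis \<open>E\<close> of the calibrated plane. The constant frame of
  a slice is of this kind at every point, whereas the plane \<open>\<xi>\<close> varies. The form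
  \<open>\<theta> \<and> (N \<lrcorner> \<omega>)\<close> vanishes on \<open>\<xi>\<close>, hence on \<open>E\<close>; if \<open>\<theta>\<close> is the coordinate dual to \<open>E\<^sub>i\<close>, its value on \<open>E\<close>
  is \<open>\<omega>(E[i := N])\<close>.\<close>

lemma calibration_zero_on_normal:
  assumes bil: "bilinear g" and sym: "\<And>v w. g v w = g w v"
    and alt: "alternating_form p \<omega>"
    and comass: "\<And>\<zeta>. unit_simple g p \<zeta> \<Longrightarrow> \<omega> \<zeta> \<le> 1"
    and \<xi>: "unit_simple g p \<xi>" "\<omega> \<xi> = 1"
    and E: "length E = p" "set E \<subseteq> span (set \<xi>)" "distinct E" "independent (set E)"
    and i: "i < p" and N: "\<And>v. v \<in> set \<xi> \<Longrightarrow> g N v = 0"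
  shows "\<omega> (E[i := N]) = 0"
proof -
  obtain \<theta> :: "_ \<Rightarrow> real" where \<theta>: "linear \<theta>" "\<And>v. v \<in> set E \<Longrightarrow> \<theta> v = (if v = E ! i then 1 else 0)"
    using linear_independent_extend[OF E(4), of "\<lambda>v. if v = E ! i then 1 else 0"] by blast
  have len: "length \<xi> = p" using \<xi> by (simp add: unit_simple_def)
  have "(\<Sum>j<p. \<theta> (E ! j) * \<omega> (E[j := N])) = 0"
  proof (rule alternating_form_zero_on_top[OF alternating_form_derivation[OF alt \<theta>(1)] len _ E(1,2)])
    show "(\<Sum>j<p. \<theta> (\<xi> ! j) * \<omega> (\<xi>[j := N])) = 0"
      using first_cousin_principle[OF bil sym alt comass \<xi> _ N] by simp
  qed
  moreover have "(\<Sum>j<p. \<theta> (E ! j) * \<omega> (E[j := N])) = (\<Sum>j<p. if j = i then \<omega> (E[j := N]) else 0)"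
    using E i \<theta>(2) by (intro sum.cong) (auto simp: nth_eq_iff_index_eq)
  ultimately show ?thesis using i by simp
qed

section \<open>Orthonormal bases of a bilinear form\<close>

text \<open>
  Gram-Schmidt for an inner product other than that of the type. The expansion of the vectors of the
  span is part of the induction, because it is how the basis is used.\<close>

lemma orthonormal_basis_exists:
  fixes g :: "'e::real_vector \<Rightarrow> 'e \<Rightarrow> real"
  assumes bil: "bilinear g" and sym: "\<And>v w. g v w = g w v" and pos: "\<And>v. v \<noteq> 0 \<Longrightarrow> g v v > 0"
    and B: "finite B"
  shows "\<exists>Q. finite Q \<and> Q \<subseteq> span B \<and> (\<forall>q\<in>Q. \<forall>r\<in>Q. g q r = (if q = r then 1 else 0)) \<and>
    (\<forall>v\<in>span B. v = (\<Sum>q\<in>Q. g v q *\<^sub>R q))"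
  using B
proof induction
  case empty
  then show ?case by (intro exI[of _ "{}"]) simp
next
  case (insert b B)
  then obtain Q where Q: "finite Q" "Q \<subseteq> span B"
    "\<And>q r. q \<in> Q \<Longrightarrow> r \<in> Q \<Longrightarrow> g q r = (if q = r then 1 else 0)"
    "\<And>v. v \<in> span B \<Longrightarrow> v = (\<Sum>q\<in>Q. g v q *\<^sub>R q)" by blast
  define u where "u = b - (\<Sum>q\<in>Q. g b q *\<^sub>R q)"
  have proj_span: "(\<Sum>q\<in>Q. g b q *\<^sub>R q) \<in> span B"
    by (intro span_sum span_scale) (use Q in auto)
  have lsum: "g (\<Sum>q\<in>Q. h q *\<^sub>R q) r = (\<Sum>q\<in>Q. h q * g q r)" for h r
  proof -
    have "linear (\<lambda>v. g v r)" using bil by (simp add: bilinear_def)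
    then show ?thesis by (simp add: linear_sum[of "\<lambda>v. g v r"] linear_scale[of "\<lambda>v. g v r"])
  qed
  have uQ: "g u q = 0" if "q \<in> Q" for q
  proof -
    have "(\<Sum>r\<in>Q. g b r * g r q) = (\<Sum>r\<in>Q. if r = q then g b r else 0)"
      by (rule sum.cong) (simp_all add: Q(3) that)
    then show ?thesis using Q(1) that by (simp add: u_def bilinear_lsub[OF bil] lsum)
  qed
  have Qu: "g q u = 0" if "q \<in> Q" for q using uQ[OF that] sym[of q u] by simp
  have sp: "span B \<subseteq> span (insert b B)" by (intro span_mono) auto
  show ?case
  proof (cases "u = 0")
    case True
    then have "b \<in> span B" using proj_span by (simp add: u_def)
    then have "span (insert b B) = span B" by (simp add: span_redundant)
    then show ?thesis using Q by (intro exI[of _ Q]) auto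
  next
    case False
    define s where "s = 1 / sqrt (g u u)"
    define q0 where "q0 = s *\<^sub>R u"
    have guu: "g u u > 0" using pos False by simp
    have q0: "g q0 q0 = 1" "\<And>q. q \<in> Q \<Longrightarrow> g q0 q = 0" "\<And>q. q \<in> Q \<Longrightarrow> g q q0 = 0"
      using uQ Qu guu
      by (auto simp: q0_def s_def bilinear_lmul[OF bil] bilinear_rmul[OF bil])
    have q0Q: "q0 \<notin> Q" using q0 by fastforce
    have u_in: "u \<in> span (insert b B)"
      unfolding u_def using proj_span sp by (intro span_diff) (auto intro: span_base)
    have w_eq: "w = (\<Sum>q\<in>insert q0 Q. g w q *\<^sub>R q)" if "w \<in> span B" for w
    proof -
      have "g w q0 = (\<Sum>q\<in>Q. g w q * g q q0)" using Q(4)[OF that] lsum by metis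
      then have "g w q0 = 0" using q0 by simp
      then show ?thesis using Q(4)[OF that] q0Q Q(1) by simp
    qed
    have "g u q0 *\<^sub>R q0 = u"
      using guu by (simp add: q0_def s_def bilinear_rmul[OF bil])
    then have u_eq: "u = (\<Sum>q\<in>insert q0 Q. g u q *\<^sub>R q)"
      using q0Q Q(1) uQ by simp
    have "v = (\<Sum>q\<in>insert q0 Q. g v q *\<^sub>R q)" if v: "v \<in> span (insert b B)" for v
    proof -
      obtain k where k: "v - k *\<^sub>R b \<in> span B" using v span_breakdown_eq by blast
      define w where "w = v - k *\<^sub>R u"
      have "w = (v - k *\<^sub>R b) + k *\<^sub>R (\<Sum>q\<in>Q. g b q *\<^sub>R q)"
        by (simp add: w_def u_def algebra_simps)
      then have wB: "w \<in> span B" using k proj_span by (auto intro: span_add span_scale)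
      have vw: "v = w + k *\<^sub>R u" by (simp add: w_def)
      have "v = (\<Sum>q\<in>insert q0 Q. g w q *\<^sub>R q) + k *\<^sub>R (\<Sum>q\<in>insert q0 Q. g u q *\<^sub>R q)"
        unfolding vw by (rule arg_cong2[OF w_eq[OF wB] arg_cong[OF u_eq]])
      also have "\<dots> = (\<Sum>q\<in>insert q0 Q. g v q *\<^sub>R q)"
        by (simp add: vw bilinear_ladd[OF bil] bilinear_lmul[OF bil] scaleR_add_left sum.distrib
            scaleR_sum_right)
      finally show ?thesis .
    qed
    moreover have "insert q0 Q \<subseteq> span (insert b B)"
      using Q(2) sp u_in by (auto simp: q0_def intro: span_scale)
    ultimately show ?thesis using Q q0 q0Q
      by (intro exI[of _ "insert q0 Q"]) auto
  qed
qed

section \<open>Calculus\<close>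

lemma smooth_on_continuous_on: "smooth_on S f \<Longrightarrow> continuous_on S f"
  unfolding smooth_on_def using Ck_on.simps(1) by blast

lemma smooth_on_differentiable: "smooth_on S f \<Longrightarrow> x \<in> S \<Longrightarrow> f differentiable (at x)"
  unfolding smooth_on_def using Ck_on.simps(2) by blast

lemma smooth_on_has_derivative:
  "smooth_on S f \<Longrightarrow> x \<in> S \<Longrightarrow> (f has_derivative frechet_derivative f (at x)) (at x)"
  using smooth_on_differentiable frechet_derivative_works by blast

lemma smooth_on_frechet_derivative:
  "smooth_on S f \<Longrightarrow> smooth_on S (\<lambda>x. frechet_derivative f (at x) v)"
  unfolding smooth_on_def using Ck_on.simps(2) by blast

lemma has_derivative_along_line:
  assumes f: "(f has_derivative D) (at (y + t *\<^sub>R v))"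
  shows "((\<lambda>s. f (y + s *\<^sub>R v)) has_vector_derivative D v) (at t)"
proof -
  have "((\<lambda>s. y + s *\<^sub>R v) has_derivative (\<lambda>s. s *\<^sub>R v)) (at t)"
    by (auto intro!: derivative_eq_intros)
  then have "((\<lambda>s. f (y + s *\<^sub>R v)) has_derivative (\<lambda>s. D (s *\<^sub>R v))) (at t)"
    using f has_derivative_compose by blast
  then show ?thesis
    unfolding has_vector_derivative_def
    by (simp add: linear_scale[OF has_derivative_linear[OF f]])
qed

text \<open>
  Only derivatives along the slice are compared, and there the functions need to agree only on the
  slice, not on a full neighbourhood.\<close>

lemma derivative_eq_along_line:
  assumes f: "(f has_derivative D) (at y)" and g: "(g has_derivative D') (at y)"
    and eq: "\<forall>\<^sub>F t in nhds 0. f (y + t *\<^sub>R v) = g (y + t *\<^sub>R v)"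
  shows "D v = D' v"
proof -
  have "((\<lambda>s. f (y + s *\<^sub>R v)) has_vector_derivative D v) (at 0)"
    "((\<lambda>s. g (y + s *\<^sub>R v)) has_vector_derivative D' v) (at 0)"
    using has_derivative_along_line[of _ _ y 0 v] f g by auto
  moreover have "\<forall>\<^sub>F t in nhds 0. t \<in> UNIV \<longrightarrow> f (y + t *\<^sub>R v) = g (y + t *\<^sub>R v)"
    using eq by simp
  then have "((\<lambda>s. f (y + s *\<^sub>R v)) has_vector_derivative D v) (at 0)
      = ((\<lambda>s. g (y + s *\<^sub>R v)) has_vector_derivative D v) (at 0)"
    by (rule has_vector_derivative_cong_ev) (rule eventually_nhds_x_imp_x[OF eq])
  ultimately show ?thesis using vector_derivative_unique_at[of "\<lambda>s. g (y + s *\<^sub>R v)" "D v" 0 "D' v"] by simp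
qed

text \<open>
  A product is differentiable at a zero of one factor even if the other factor is only continuous. This
  breaks the circle in \<open>nondegenerate_system_solution_differentiable\<close>, where the differentiability of \<open>G\<close> is to be deduced from an
  equation that contains \<open>G\<close>.\<close>

lemma has_derivative_mult_vanishing:
  fixes f g :: "'a::real_normed_vector \<Rightarrow> real"
  assumes f: "(f has_derivative D) (at y)" and f0: "f y = 0" and g: "isCont g y"
  shows "((\<lambda>z. g z * f z) has_derivative (\<lambda>h. g y * D h)) (at y)"
  unfolding has_derivative_at_alt
proof (intro conjI allI impI)
  have D: "bounded_linear D" using f has_derivative_bounded_linear by blast
  then show "bounded_linear (\<lambda>h. g y * D h)" by (rule bounded_linear_const_mult)
  obtain L where L: "L > 0" "\<And>h. norm (D h) \<le> norm h * L" using bounded_linear.pos_bounded[OF D] by blast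
  have ex: "\<exists>d>0. \<forall>z. norm (z - y) < d \<longrightarrow> norm (f z - f y - D (z - y)) \<le> e * norm (z - y)" if "e > 0" for e
    using f that unfolding has_derivative_at_alt by blast
  fix e :: real assume e: "e > 0"
  define e1 where "e1 = e / (2 * (1 + L))"
  define e2 where "e2 = e / (2 * (1 + \<bar>g y\<bar>))"
  have e1: "e1 > 0" and e2: "e2 > 0" using e L by (auto simp: e1_def e2_def)
  obtain d1 where d1: "d1 > 0" "\<And>z. norm (z - y) < d1 \<Longrightarrow> norm (f z - D (z - y)) \<le> 1 * norm (z - y)"
    using ex[of 1] f0 by auto
  obtain d2 where d2: "d2 > 0" "\<And>z. norm (z - y) < d2 \<Longrightarrow> norm (f z - D (z - y)) \<le> e2 * norm (z - y)"
    using ex[OF e2] f0 by auto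
  obtain d3 where d3: "d3 > 0" "\<And>z. norm (z - y) < d3 \<Longrightarrow> \<bar>g z - g y\<bar> < e1"
    using g e1 unfolding continuous_at_eps_delta dist_norm by (metis real_norm_def)
  have "norm (g z * f z - g y * f y - g y * D (z - y)) \<le> e * norm (z - y)"
    if z: "norm (z - y) < min d1 (min d2 d3)" for z
  proof -
    have "norm (f z) \<le> norm (f z - D (z - y)) + norm (D (z - y))"
      using norm_triangle_ineq[of "f z - D (z - y)" "D (z - y)"] by simp
    also have "\<dots> \<le> (1 + L) * norm (z - y)"
      using d1(2)[of z] L(2)[of "z - y"] z by (auto simp: algebra_simps)
    finally have "norm (g z - g y) * norm (f z) \<le> e1 * ((1 + L) * norm (z - y))"
      using d3(2)[of z] z L by (intro mult_mono) (auto simp: less_imp_le)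
    also have "\<dots> = e / 2 * norm (z - y)" using L by (simp add: e1_def field_simps)
    finally have a: "norm (g z - g y) * norm (f z) \<le> e / 2 * norm (z - y)" .
    have "norm (g y) * norm (f z - D (z - y)) \<le> (1 + \<bar>g y\<bar>) * (e2 * norm (z - y))"
      using d2(2)[of z] z e2 by (intro mult_mono) auto
    also have "\<dots> = e / 2 * norm (z - y)" by (simp add: e2_def field_simps)
    finally have b: "norm (g y) * norm (f z - D (z - y)) \<le> e / 2 * norm (z - y)" .
    have "g z * f z - g y * f y - g y * D (z - y) = (g z - g y) * f z + g y * (f z - D (z - y))"
      using f0 by (simp add: algebra_simps)
    then have "norm (g z * f z - g y * f y - g y * D (z - y))
        \<le> norm (g z - g y) * norm (f z) + norm (g y) * norm (f z - D (z - y))"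
      by (metis norm_mult norm_triangle_ineq)
    then show ?thesis using a b by simp
  qed
  then show "\<exists>d>0. \<forall>z. norm (z - y) < d \<longrightarrow>
      norm (g z * f z - g y * f y - g y * D (z - y)) \<le> e * norm (z - y)"
    using d1(1) d2(1) d3(1) by (intro exI[of _ "min d1 (min d2 d3)"]) auto
qed

lemma bilinear_form_expand_left:
  fixes g :: "'e::euclidean_space \<Rightarrow> 'e \<Rightarrow> real"
  assumes "bilinear g"
  shows "g v w = (\<Sum>b\<in>Basis. (v \<bullet> b) * g b w)"
proof -
  have lin: "linear (\<lambda>v. g v w)" using assms by (simp add: bilinear_def)
  have "g v w = g (\<Sum>b\<in>Basis. (v \<bullet> b) *\<^sub>R b) w" by (simp add: euclidean_representation)
  then show ?thesis by (simp add: linear_sum[OF lin] linear_scale[OF lin])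
qed

text \<open>
  With \<open>A\<close> the matrix of \<open>\<gamma>\<close> at \<open>y\<close> and \<open>B\<close> its inverse, the system reads
  \<open>G z = B (\<beta> z - R z)\<close>, where \<open>R z = (\<gamma> z - \<gamma> y) (G z)\<close> is small near \<open>y\<close>. The equation gives in turn
  that \<open>G\<close> is bounded near \<open>y\<close>, that it is continuous at \<open>y\<close>, and that it is differentiable at \<open>y\<close>.
  It is applied to the Riemannian gradient.\<close>

lemma nondegenerate_system_solution_differentiable:
  fixes \<gamma> :: "'a::real_normed_vector \<Rightarrow> 'e::euclidean_space \<Rightarrow> 'e \<Rightarrow> real"
  assumes U: "open U" "y \<in> U" and bil: "\<And>z. z \<in> U \<Longrightarrow> bilinear (\<gamma> z)"
    and pos: "\<And>v. v \<noteq> 0 \<Longrightarrow> \<gamma> y v v > 0"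
    and \<gamma>: "\<And>v w. (\<lambda>z. \<gamma> z v w) differentiable (at y)"
    and \<beta>: "\<And>w. (\<lambda>z. \<beta> z w) differentiable (at y)"
    and sol: "\<And>z w. z \<in> U \<Longrightarrow> \<gamma> z (G z) w = \<beta> z w"
  shows "G differentiable (at y)"
proof -
  define A where "A v = (\<Sum>b\<in>Basis. \<gamma> y v b *\<^sub>R b)" for v
  have bily: "bilinear (\<gamma> y)" using bil U by blast
  have liny: "linear (\<lambda>v. \<gamma> y v w)" for w using bily by (simp add: bilinear_def)
  have linA: "linear A"
    unfolding A_def
    by (rule linearI) (simp_all add: bilinear_ladd[OF bily] bilinear_lmul[OF bily] scaleR_add_left
        sum.distrib scaleR_sum_right)
  have "v = 0" if "A v = 0" for v
  proof -
    have "\<gamma> y v b = 0" if b: "b \<in> Basis" for b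
    proof -
      have "A v \<bullet> b = \<gamma> y v b" using b by (simp add: A_def inner_sum_left inner_Basis if_distrib cong: if_cong)
      then show ?thesis using \<open>A v = 0\<close> by simp
    qed
    moreover have "linear (\<gamma> y v)" using bily by (simp add: bilinear_def)
    ultimately have "\<gamma> y v v = 0"
      using linear_eq_0_on_span[of "\<gamma> y v" Basis v] by (simp add: span_Basis)
    then show ?thesis using pos by force
  qed
  then have "inj A" using linA linear_injective_0 by blast
  then obtain B where B: "linear B" "B \<circ> A = id" using linA linear_injective_left_inverse by blast
  then obtain C where C: "C > 0" "\<And>v. norm (B v) \<le> C * norm v" using linear_bounded_pos by blast
  define R where "R z b = (\<Sum>c\<in>Basis. (G z \<bullet> c) * (\<gamma> z c b - \<gamma> y c b))" for z b
  have G_eq: "G z = B (\<Sum>b\<in>Basis. (\<beta> z b - R z b) *\<^sub>R b)" if "z \<in> U" for z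
  proof -
    have "R z b = \<gamma> z (G z) b - \<gamma> y (G z) b" for b
      using bilinear_form_expand_left[OF bil[OF that], of "G z" b]
        bilinear_form_expand_left[OF bily, of "G z" b]
      by (simp add: R_def right_diff_distrib sum_subtractf)
    then have "A (G z) = (\<Sum>b\<in>Basis. (\<beta> z b - R z b) *\<^sub>R b)" using sol that by (simp add: A_def)
    then show ?thesis using B(2) by (metis comp_apply id_apply)
  qed
  have \<gamma>c: "((\<lambda>z. \<gamma> z c b - \<gamma> y c b) \<longlongrightarrow> 0) (at y)" for b c
    using differentiable_imp_continuous_within[OF \<gamma>[of c b]]
    by (simp add: continuous_within LIM_zero)
  have \<beta>c: "((\<lambda>z. \<beta> z b) \<longlongrightarrow> \<beta> y b) (at y)" for b
    using differentiable_imp_continuous_within[OF \<beta>[of b]] by (simp add: continuous_within)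
  have evU: "\<forall>\<^sub>F z in at y. z \<in> U" using U by (simp add: eventually_at_in_open')
  \<comment> \<open>near \<open>y\<close> the remainder is at most half of \<open>norm (G z)\<close> and can be absorbed\<close>
  have bdd: "Bfun G (at y)"
  proof -
    define s where "s z = (\<Sum>b\<in>Basis. \<Sum>c\<in>Basis. \<bar>\<gamma> z c b - \<gamma> y c b\<bar>)" for z
    define t where "t z = (\<Sum>b\<in>Basis. \<bar>\<beta> z b\<bar>)" for z
    have "(s \<longlongrightarrow> (\<Sum>b\<in>(Basis::'e set). \<Sum>c\<in>(Basis::'e set). \<bar>0\<bar>)) (at y)"
      unfolding s_def by (intro tendsto_sum tendsto_rabs \<gamma>c)
    then have "(s \<longlongrightarrow> 0) (at y)" by simp
    then have evs: "\<forall>\<^sub>F z in at y. s z < 1 / (2 * C)" using C(1) by (intro order_tendstoD) auto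
    have "(t \<longlongrightarrow> t y) (at y)" unfolding t_def by (intro tendsto_sum tendsto_rabs \<beta>c)
    then have evt: "\<forall>\<^sub>F z in at y. t z < t y + 1" by (intro order_tendstoD) auto
    have "\<forall>\<^sub>F z in at y. norm (G z) \<le> 2 * C * (t y + 1)"
      using evU evs evt
    proof eventually_elim
      case (elim z)
      have Rb: "\<bar>R z b\<bar> \<le> norm (G z) * (\<Sum>c\<in>Basis. \<bar>\<gamma> z c b - \<gamma> y c b\<bar>)" for b
        unfolding R_def sum_distrib_left
        by (intro sum_norm_le[of _ "\<lambda>c. (G z \<bullet> c) * (\<gamma> z c b - \<gamma> y c b)", simplified real_norm_def])
          (auto simp: abs_mult intro: mult_right_mono Basis_le_norm)
      have "norm (\<Sum>b\<in>Basis. (\<beta> z b - R z b) *\<^sub>R b) \<le> (\<Sum>b\<in>Basis. \<bar>\<beta> z b\<bar> + \<bar>R z b\<bar>)"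
        by (intro sum_norm_le) auto
      also have "\<dots> \<le> t z + norm (G z) * s z"
        unfolding t_def s_def sum_distrib_left[of "norm (G z)"] sum.distrib[symmetric]
        by (intro sum_mono add_left_mono) (use Rb in \<open>simp add: sum_distrib_left\<close>)
      finally have "C * norm (\<Sum>b\<in>Basis. (\<beta> z b - R z b) *\<^sub>R b) \<le> C * (t z + norm (G z) * s z)"
        using C(1) by simp
      then have "norm (G z) \<le> C * (t z + norm (G z) * s z)"
        using C(2) G_eq[OF elim(1)] by (metis order_trans)
      also have "\<dots> \<le> C * (t y + 1 + norm (G z) * (1 / (2 * C)))"
        using elim C(1) by (intro mult_left_mono add_mono) auto
      also have "\<dots> = C * (t y + 1) + norm (G z) / 2" using C(1) by (simp add: field_simps)
      finally show ?case by simp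
    qed
    then show ?thesis by (rule BfunI)
  qed
  have R0: "((\<lambda>z. R z b) \<longlongrightarrow> 0) (at y)" for b
  proof -
    have "((\<lambda>z. (G z \<bullet> c) * (\<gamma> z c b - \<gamma> y c b)) \<longlongrightarrow> 0) (at y)" for c
    proof -
      obtain M where M: "\<forall>\<^sub>F z in at y. norm (G z) \<le> M" using bdd unfolding Bfun_def by blast
      have "((\<lambda>z. (M * norm c) * \<bar>\<gamma> z c b - \<gamma> y c b\<bar>) \<longlongrightarrow> (M * norm c) * \<bar>0\<bar>) (at y)"
        by (intro tendsto_intros \<gamma>c)
      then have "((\<lambda>z. (M * norm c) * \<bar>\<gamma> z c b - \<gamma> y c b\<bar>) \<longlongrightarrow> 0) (at y)" by simp
      then show ?thesis
      proof (rule Lim_null_comparison[rotated])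
        show "\<forall>\<^sub>F z in at y. norm ((G z \<bullet> c) * (\<gamma> z c b - \<gamma> y c b)) \<le> M * norm c * \<bar>\<gamma> z c b - \<gamma> y c b\<bar>"
          using M
        proof eventually_elim
          case (elim z)
          have "\<bar>G z \<bullet> c\<bar> \<le> norm (G z) * norm c" by (rule Cauchy_Schwarz_ineq2)
          also have "\<dots> \<le> M * norm c" using elim by (intro mult_right_mono) auto
          finally show ?case by (simp add: abs_mult mult_right_mono)
        qed
      qed
    qed
    from tendsto_sum[of Basis, OF this] show ?thesis unfolding R_def by simp
  qed
  have Gc: "isCont G y"
  proof -
    have Bc: "isCont B v" for v using B(1) linear_continuous_at linear_conv_bounded_linear by blast
    have "((\<lambda>z. \<Sum>b\<in>Basis. (\<beta> z b - R z b) *\<^sub>R b) \<longlongrightarrow> (\<Sum>b\<in>Basis. (\<beta> y b - 0) *\<^sub>R b)) (at y)"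
      by (intro tendsto_intros \<beta>c R0)
    moreover have "R y b = 0" for b by (simp add: R_def)
    ultimately have "((\<lambda>z. B (\<Sum>b\<in>Basis. (\<beta> z b - R z b) *\<^sub>R b)) \<longlongrightarrow> G y) (at y)"
      unfolding G_eq[OF U(2)] using isCont_tendsto_compose[OF Bc] by simp
    moreover have "\<forall>\<^sub>F z in at y. B (\<Sum>b\<in>Basis. (\<beta> z b - R z b) *\<^sub>R b) = G z"
      using evU by eventually_elim (simp add: G_eq[symmetric])
    ultimately show ?thesis unfolding isCont_def using Lim_transform_eventually by blast
  qed
  have "(\<lambda>z. R z b) differentiable (at y)" for b
    unfolding R_def
  proof (intro differentiable_sum ballI finite_Basis)
    fix c :: 'e
    obtain D where "((\<lambda>z. \<gamma> z c b) has_derivative D) (at y)"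
      using \<gamma>[of c b] unfolding differentiable_def by blast
    then have "((\<lambda>z. \<gamma> z c b - \<gamma> y c b) has_derivative D) (at y)"
      by (auto intro!: derivative_eq_intros)
    moreover have "isCont (\<lambda>z. G z \<bullet> c) y" using Gc by (intro continuous_intros)
    ultimately show "(\<lambda>z. (G z \<bullet> c) * (\<gamma> z c b - \<gamma> y c b)) differentiable (at y)"
      unfolding differentiable_def using has_derivative_mult_vanishing by fastforce
  qed
  then have "(\<lambda>z. \<Sum>b\<in>Basis. (\<beta> z b - R z b) *\<^sub>R b) differentiable (at y)"
    by (intro differentiable_sum ballI finite_Basis differentiable_scaleR differentiable_diff \<beta>) auto
  moreover have "B differentiable (at v)" for v
    using B(1) linear_imp_differentiable by blast
  ultimately have "(\<lambda>z. B (\<Sum>b\<in>Basis. (\<beta> z b - R z b) *\<^sub>R b)) differentiable (at y)"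
    using differentiable_compose[of B] by blast
  then obtain D where "((\<lambda>z. B (\<Sum>b\<in>Basis. (\<beta> z b - R z b) *\<^sub>R b)) has_derivative D) (at y)"
    unfolding differentiable_def by blast
  then have "(G has_derivative D) (at y)"
    by (rule has_derivative_transform_within_open[OF _ U]) (simp add: G_eq[symmetric])
  then show ?thesis unfolding differentiable_def by blast
qed

lemma uniform_ellipticity_on_compact:
  fixes \<gamma> :: "'a::metric_space \<Rightarrow> 'e::euclidean_space \<Rightarrow> 'e \<Rightarrow> real"
  assumes K: "compact K" and bil: "\<And>z. z \<in> K \<Longrightarrow> bilinear (\<gamma> z)"
    and pos: "\<And>z v. z \<in> K \<Longrightarrow> v \<noteq> 0 \<Longrightarrow> \<gamma> z v v > 0"
    and cont: "\<And>v w. continuous_on K (\<lambda>z. \<gamma> z v w)"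
  obtains l L where "l > 0" "L > 0"
    "\<And>z v. z \<in> K \<Longrightarrow> l * (norm v)\<^sup>2 \<le> \<gamma> z v v" "\<And>z v. z \<in> K \<Longrightarrow> \<gamma> z v v \<le> L * (norm v)\<^sup>2"
proof (cases "K = {}")
  case True
  then show ?thesis using that[of 1 1] by simp
next
  case False
  let ?S = "K \<times> sphere (0::'e) 1"
  let ?q = "\<lambda>(z, v). \<gamma> z v v"
  have comp: "compact ?S" using K by (intro compact_Times) auto
  obtain b :: 'e where "b \<in> Basis" using nonempty_Basis by blast
  then have ne: "?S \<noteq> {}" using False by (auto intro!: exI[of _ b])
  have q_eq: "?q zv = (\<Sum>b\<in>Basis. (snd zv \<bullet> b) * (\<Sum>c\<in>Basis. (snd zv \<bullet> c) * \<gamma> (fst zv) b c))"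
    if "zv \<in> ?S" for zv
  proof -
    define z v where "z = fst zv" and "v = snd zv"
    have zv: "zv = (z, v)" "z \<in> K" using that by (auto simp: z_def v_def)
    have bil': "bilinear (\<lambda>v w. \<gamma> z w v)" using bil[OF zv(2)] by (auto simp: bilinear_def)
    have "\<gamma> z v v = (\<Sum>b\<in>Basis. (v \<bullet> b) * \<gamma> z b v)"
      by (rule bilinear_form_expand_left[OF bil[OF zv(2)]])
    also have "\<dots> = (\<Sum>b\<in>Basis. (v \<bullet> b) * (\<Sum>c\<in>Basis. (v \<bullet> c) * \<gamma> z b c))"
      by (intro sum.cong arg_cong2[where f = "(*)"] refl bilinear_form_expand_left[OF bil'])
    finally show ?thesis by (simp only: zv(1) prod.case fst_conv snd_conv)
  qed
  have "continuous_on ?S (\<lambda>zv. \<gamma> (fst zv) b c)" for b c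
    by (rule continuous_on_compose2[OF cont]) (auto intro: continuous_intros)
  then have "continuous_on ?S
      (\<lambda>zv. \<Sum>b\<in>Basis. (snd zv \<bullet> b) * (\<Sum>c\<in>Basis. (snd zv \<bullet> c) * \<gamma> (fst zv) b c))"
    by (intro continuous_intros)
  then have contq: "continuous_on ?S ?q"
    by (rule continuous_on_eq) (rule q_eq[symmetric])
  obtain zl where zl: "zl \<in> ?S" "\<And>s. s \<in> ?S \<Longrightarrow> ?q zl \<le> ?q s"
    using continuous_attains_inf[OF comp ne contq] by blast
  obtain zL where zL: "zL \<in> ?S" "\<And>s. s \<in> ?S \<Longrightarrow> ?q s \<le> ?q zL"
    using continuous_attains_sup[OF comp ne contq] by blast
  have hom: "\<gamma> z v v = (norm v)\<^sup>2 * \<gamma> z (v /\<^sub>R norm v) (v /\<^sub>R norm v)"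
    if "z \<in> K" "v \<noteq> 0" for z v
    using that by (simp add: bilinear_lmul[OF bil] bilinear_rmul[OF bil] power2_eq_square field_simps)
  have zero: "\<gamma> z 0 0 = 0" if "z \<in> K" for z using bilinear_lzero[OF bil[OF that]] by simp
  show ?thesis
  proof (rule that[of "?q zl" "?q zL"])
    have "?q s > 0" if "s \<in> ?S" for s
      using that pos[of "fst s" "snd s"] by (cases s) (cases "snd s = 0"; auto)
    then show "?q zl > 0" "?q zL > 0" using zl(1) zL(1) by blast+
    fix z and v :: 'e assume z: "z \<in> K"
    show "?q zl * (norm v)\<^sup>2 \<le> \<gamma> z v v"
    proof (cases "v = 0")
      case False
      then have "?q zl \<le> \<gamma> z (v /\<^sub>R norm v) (v /\<^sub>R norm v)"
        using zl(2)[of "(z, v /\<^sub>R norm v)"] z by simp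
      then show ?thesis
        unfolding hom[OF z False] by (subst mult.commute) (simp add: mult_left_mono mult.commute)
    qed (use zero[OF z] in simp)
    show "\<gamma> z v v \<le> ?q zL * (norm v)\<^sup>2"
    proof (cases "v = 0")
      case False
      then have "\<gamma> z (v /\<^sub>R norm v) (v /\<^sub>R norm v) \<le> ?q zL"
        using zL(2)[of "(z, v /\<^sub>R norm v)"] z by simp
      then show ?thesis
        unfolding hom[OF z False] by (subst mult.commute) (simp add: mult_left_mono mult.commute)
    qed (use zero[OF z] in simp)
  qed
qed

section \<open>The strong maximum principle\<close>

lemma second_derivative_nonpos_at_local_max:
  fixes u :: "real \<Rightarrow> real"
  assumes d: "d > 0" and u: "\<And>t. \<bar>t\<bar> < d \<Longrightarrow> (u has_real_derivative u' t) (at t)"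
    and u': "(u' has_real_derivative c) (at 0)" and max: "\<And>t. \<bar>t\<bar> < d \<Longrightarrow> u t \<le> u 0"
  shows "u' 0 = 0" "c \<le> 0"
proof -
  show zero: "u' 0 = 0"
    using DERIV_local_max[of u "u' 0" 0 d] u[of 0] d max by auto
  show "c \<le> 0"
  proof (rule ccontr)
    assume "\<not> c \<le> 0"
    then obtain e where e: "e > 0" "\<And>h. 0 < h \<Longrightarrow> h < e \<Longrightarrow> u' h > 0"
      using DERIV_pos_inc_right[OF u'] zero by auto
    define t where "t = min d e / 2"
    have t: "0 < t" "t < d" "t < e" using d e by (auto simp: t_def)
    have "u 0 < u t"
    proof (rule DERIV_pos_imp_increasing_open[OF t(1)])
      fix s assume "0 < s" "s < t"
      then show "\<exists>y. (u has_real_derivative y) (at s) \<and> 0 < y"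
        using u[of s] e(2)[of s] t by auto
      next
      show "continuous_on {0..t} u"
        by (intro continuous_at_imp_continuous_on ballI DERIV_isCont[OF u]) (use t in auto)
    qed
    then show False using max[of t] t by simp
  qed
qed

text \<open>
  Hopf's argument for functions on the subspace \<open>P\<close>. The vectors of \<open>Q\<close> diagonalise the second order
  part at \<open>y\<close>; the first bound on \<open>Q\<close> is the ellipticity, the second the boundedness of the
  coefficients, and the third is the differential inequality, \<open>b\<close> being a bound for \<open>dF\<close> on \<open>P\<close>.

  If \<open>F\<close> were smaller than its maximum \<open>m\<close> at some point, there would be a ball with \<open>F < m\<close> inside and
  \<open>F z = m\<close> at a single boundary point \<open>z\<close>. Add to \<open>F\<close> a small multiple \<open>\<eta>\<close> of the barrier
  \<open>exp (- \<mu> \<bar>y - y1\<bar>\<^sup>2) - exp (- \<mu> \<rho>\<^sup>2)\<close>, which is positive inside that ball and negative outside. The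
  sum has a maximum in the interior of a small ball around \<open>z\<close>, and there the conditions on the first two
  derivatives contradict the differential inequality when \<open>\<mu>\<close> is large.\<close>

lemma strong_maximum_principle:
  fixes F :: "'e::euclidean_space \<Rightarrow> real"
  assumes P: "subspace P" and x0: "x0 \<in> P" and r: "r > 0" and \<kappa>: "\<kappa> > 0"
    and dF: "\<And>y. y \<in> ball x0 r \<Longrightarrow> (F has_derivative dF y) (at y)"
    and HF: "\<And>y v. y \<in> ball x0 r \<Longrightarrow> ((\<lambda>z. dF z v) has_derivative H y v) (at y)"
    and ell: "\<And>y. y \<in> ball x0 r \<inter> P \<Longrightarrow> \<exists>Q. finite Q \<and> Q \<subseteq> P \<and>
      (\<forall>v\<in>P. \<kappa> * (norm v)\<^sup>2 \<le> (\<Sum>q\<in>Q. (v \<bullet> q)\<^sup>2)) \<and> (\<Sum>q\<in>Q. (norm q)\<^sup>2) \<le> K \<and>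
      (\<forall>b. (\<forall>v\<in>P. \<bar>dF y v\<bar> \<le> b * norm v) \<longrightarrow> \<bar>\<Sum>q\<in>Q. H y q q\<bar> \<le> K * b)"
    and max: "\<And>y. y \<in> ball x0 r \<inter> P \<Longrightarrow> F y \<le> F x0"
    and y0: "y0 \<in> ball x0 (r / 2) \<inter> P"
  shows "F y0 = F x0"
proof (rule ccontr)
  define m where "m = F x0"
  assume "F y0 \<noteq> F x0"
  then have Fy0: "F y0 < m" using max[of y0] y0 r by (auto simp: m_def)
  define \<delta>0 where "\<delta>0 = dist y0 x0"
  have \<delta>0: "\<delta>0 < r / 2" using y0 by (simp add: \<delta>0_def dist_commute)
  have Pcl: "closed P" using P closed_subspace by blast
  have contF: "continuous_on (ball x0 r) F"
    using dF has_derivative_continuous by (intro continuous_at_imp_continuous_on) blast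
  have cb: "cball y0 \<delta>0 \<subseteq> ball x0 r"
  proof
    fix y assume "y \<in> cball y0 \<delta>0"
    then show "y \<in> ball x0 r"
      using \<delta>0 dist_triangle[of x0 y y0] by (simp add: \<delta>0_def dist_commute)
  qed
  \<comment> \<open>\<open>z\<close> is a point of the maximum set nearest to \<open>y0\<close>, so \<open>F < m\<close> in the open ball of radius \<open>R\<close>\<close>
  define Z where "Z = {y \<in> cball y0 \<delta>0 \<inter> P. F y = m}"
  have "closed (cball y0 \<delta>0 \<inter> P)" using Pcl by auto
  then have "closed Z"
    unfolding Z_def
    by (intro continuous_closed_preimage_constant continuous_on_subset[OF contF]) (use cb in auto)
  then have "compact Z"
    unfolding compact_eq_bounded_closed Z_def
    by (auto intro: bounded_subset[OF bounded_cball[of y0 \<delta>0]])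
  moreover have "x0 \<in> Z" using x0 by (simp add: Z_def \<delta>0_def m_def)
  ultimately obtain z where z: "z \<in> Z" "\<And>y. y \<in> Z \<Longrightarrow> dist y0 z \<le> dist y0 y"
    using continuous_attains_inf[of Z "dist y0"] continuous_on_dist[OF continuous_on_const continuous_on_id]
    by blast
  define R where "R = dist y0 z"
  have zP: "z \<in> P" and Fz: "F z = m" and R\<delta>: "R \<le> \<delta>0" using z by (auto simp: Z_def R_def)
  have y0P: "y0 \<in> P" using y0 by simp
  have R: "R > 0" using Fz Fy0 by (auto simp: R_def)
  have zball: "z \<in> ball x0 r" using z cb by (auto simp: Z_def)
  have inside: "F y < m" if "y \<in> P" "dist y0 y < R" for y
  proof -
    have y: "y \<in> cball y0 \<delta>0" using that R\<delta> by simp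
    then have "F y \<le> m" using max[of y] cb that by (auto simp: m_def)
    moreover have "F y \<noteq> m" using z(2)[of y] y that by (auto simp: Z_def R_def)
    ultimately show ?thesis by simp
  qed
  \<comment> \<open>halving the ball towards \<open>z\<close> makes \<open>z\<close> the only boundary point where \<open>F = m\<close> is possible\<close>
  define y1 where "y1 = (1/2) *\<^sub>R (y0 + z)"
  define \<rho> where "\<rho> = R / 2"
  have \<rho>: "\<rho> > 0" using R by (simp add: \<rho>_def)
  have y1P: "y1 \<in> P" unfolding y1_def using P y0P zP by (simp add: subspace_add subspace_scale)
  have zy1: "norm (z - y1) = \<rho>"
  proof -
    have "z - y1 = (1/2) *\<^sub>R (z - y0)"
      by (simp add: y1_def algebra_simps flip: scaleR_add_left)
    then show ?thesis by (simp add: \<rho>_def R_def dist_norm norm_minus_commute)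
  qed
  have tangent: "dist y0 y < R" if "norm (y - y1) \<le> \<rho>" "y \<noteq> z" for y
  proof -
    have par: "(norm (a + b))\<^sup>2 + (norm (a - b))\<^sup>2 = 2 * (norm a)\<^sup>2 + 2 * (norm b)\<^sup>2" for a b :: 'e
      by (simp add: power2_norm_eq_inner inner_add_left inner_add_right inner_diff_left
          inner_diff_right inner_commute)
    have split: "y - y0 = (y - y1) + (z - y1)" "y - z = (y - y1) - (z - y1)"
      by (simp_all add: y1_def algebra_simps flip: scaleR_add_left)
    then have "(norm (y - y0))\<^sup>2 + (norm (y - z))\<^sup>2 = 2 * (norm (y - y1))\<^sup>2 + 2 * \<rho>\<^sup>2"
      using par[of "y - y1" "z - y1"] unfolding split[symmetric] zy1 by simp
    moreover have "(norm (y - y1))\<^sup>2 \<le> \<rho>\<^sup>2" using that by (intro power_mono) auto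
    moreover have "(norm (y - z))\<^sup>2 > 0" using that by simp
    moreover have "\<rho>\<^sup>2 = R\<^sup>2 / 4" by (simp add: \<rho>_def power_divide)
    ultimately have "(norm (y - y0))\<^sup>2 < R\<^sup>2" by linarith
    then have "norm (y - y0) < R" using R by (simp add: power_less_imp_less_base)
    then show ?thesis by (simp add: dist_norm norm_minus_commute)
  qed
  have K: "0 \<le> K"
  proof -
    obtain Q :: "'e set" where "(\<Sum>q\<in>Q. (norm q)\<^sup>2) \<le> K" using ell[of x0] x0 r by auto
    then show ?thesis using sum_nonneg[of Q "\<lambda>q. (norm q)\<^sup>2"] by simp
  qed
  \<comment> \<open>chosen so that \<open>2 \<mu> \<kappa> (\<rho> / 2)\<^sup>2\<close> exceeds \<open>K (1 + \<bar>y - y1\<bar>)\<close> for all \<open>y\<close> with \<open>\<bar>y - y1\<bar> \<le> 2 \<rho>\<close>\<close>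
  define \<mu> where "\<mu> = 2 * (K * (1 + 2 * \<rho>) + 1) / (\<kappa> * \<rho>\<^sup>2)"
  have \<mu>: "\<mu> > 0" using K \<kappa> \<rho> by (auto simp: \<mu>_def intro!: divide_pos_pos mult_pos_pos add_nonneg_pos)
  \<comment> \<open>\<open>\<delta> \<le> \<rho> / 2\<close> keeps the points near \<open>z\<close> away from the centre \<open>y1\<close>, where the gradient of the barrier vanishes\<close>
  define \<delta> where "\<delta> = min (\<rho> / 2) ((r - dist x0 z) / 2)"
  have \<delta>: "\<delta> > 0" "\<delta> \<le> \<rho> / 2" using \<rho> zball by (auto simp: \<delta>_def)
  have cbz: "cball z \<delta> \<subseteq> ball x0 r"
  proof
    fix y assume y: "y \<in> cball z \<delta>"
    have "\<delta> < r - dist x0 z" using zball by (auto simp: \<delta>_def min_def)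
    then show "y \<in> ball x0 r" using y dist_triangle[of x0 y z] by simp
  qed
  define E where "E y = exp (- \<mu> * (norm (y - y1))\<^sup>2)" for y
  define h where "h y = E y - exp (- \<mu> * \<rho>\<^sup>2)" for y
  have E1: "E y \<le> 1" "E y > 0" for y using \<mu> by (auto simp: E_def)
  have h1: "h y < 1" for y using E1(1)[of y] exp_gt_zero[of "- \<mu> * \<rho>\<^sup>2"] unfolding h_def by linarith
  \<comment> \<open>the part of the small sphere where the barrier is nonnegative; \<open>F\<close> stays below \<open>m\<close> on it\<close>
  define C where "C = sphere z \<delta> \<inter> cball y1 \<rho> \<inter> P"
  have compC: "compact C" unfolding C_def using Pcl by (intro compact_Int_closed) auto
  have FC: "F y < m" if "y \<in> C" for y
    using inside[of y] tangent[of y] that \<delta>(1)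
    by (auto simp: C_def dist_norm norm_minus_commute)
  have C_sub: "C \<subseteq> ball x0 r" using cbz by (auto simp: C_def)
  obtain \<eta> where \<eta>: "\<eta> > 0" "\<And>y. y \<in> C \<Longrightarrow> F y \<le> m - \<eta>"
  proof (cases "C = {}")
    case True
    then show ?thesis using that[of 1] by simp
  next
    case False
    then obtain c where "c \<in> C" "\<And>y. y \<in> C \<Longrightarrow> F y \<le> F c"
      using continuous_attains_sup[OF compC False continuous_on_subset[OF contF C_sub]] by blast
    then show ?thesis using that[of "m - F c"] FC by simp
  qed
  define w where "w y = F y + \<eta> * h y" for y
  have "continuous_on (cball z \<delta> \<inter> P) w"
    unfolding w_def h_def E_def
    by (intro continuous_intros continuous_on_subset[OF contF]) (use cbz in auto)
  moreover have "z \<in> cball z \<delta> \<inter> P" using zP \<delta>(1) by simp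
  moreover have "compact (cball z \<delta> \<inter> P)" using Pcl by (intro compact_Int_closed) auto
  ultimately obtain y where y: "y \<in> cball z \<delta> \<inter> P" "\<And>x. x \<in> cball z \<delta> \<inter> P \<Longrightarrow> w x \<le> w y"
    using continuous_attains_sup[of "cball z \<delta> \<inter> P" w] by blast
  have "w z = m" using zy1 Fz by (simp add: w_def h_def E_def)
  then have wy: "m \<le> w y" using y(2)[of z] zP \<delta>(1) by simp
  have yP: "y \<in> P" and yball: "y \<in> ball x0 r" using y cbz by auto
  have "y \<notin> sphere z \<delta>"
  proof
    assume ys: "y \<in> sphere z \<delta>"
    show False
    proof (cases "y \<in> cball y1 \<rho>")
      case True
      then have "F y \<le> m - \<eta>" using ys yP \<eta>(2)[of y] by (simp add: C_def)
      moreover have "\<eta> * h y < \<eta> * 1" using \<eta>(1) h1 by (intro mult_strict_left_mono)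
      ultimately show False using wy by (simp add: w_def)
    next
      case False
      then have "\<rho> < norm (y - y1)" by (simp add: dist_norm norm_minus_commute)
      then have "\<rho>\<^sup>2 < (norm (y - y1))\<^sup>2" using \<rho> by (intro power_strict_mono) auto
      then have "h y < 0" using \<mu> by (simp add: h_def E_def)
      then have "\<eta> * h y < 0" using \<eta>(1) by (simp add: mult_pos_neg)
      moreover have "F y \<le> m" using max[of y] yP yball by (simp add: m_def)
      ultimately show False using wy by (simp add: w_def)
    qed
  qed
  then have yint: "dist z y < \<delta>" using y(1) by auto
  define d where "d = y - y1"
  have dP: "d \<in> P" unfolding d_def using P yP y1P by (rule subspace_diff)
  have dn: "\<rho> / 2 \<le> norm d" "norm d \<le> 2 * \<rho>"
  proof -
    have "norm (z - y) \<le> \<rho> / 2" using yint \<delta>(2) by (simp add: dist_norm)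
    moreover have "norm (z - y1) \<le> norm (z - y) + norm d"
      using norm_triangle_ineq[of "z - y" d] by (simp add: d_def)
    moreover have "norm d \<le> norm (z - y1) + norm (z - y)"
      using norm_triangle_ineq4[of "z - y1" "z - y"] by (simp add: d_def)
    ultimately show "\<rho> / 2 \<le> norm d" "norm d \<le> 2 * \<rho>" using zy1 by linarith+
  qed
  have linear_dF: "linear (dF y)" using dF[OF yball] has_derivative_linear by blast
  \<comment> \<open>the first and second order conditions at the interior maximum \<open>y\<close> of \<open>F + \<eta> h\<close>, along a line in \<open>P\<close>\<close>
  have second: "dF y q = 2 * \<mu> * \<eta> * E y * (d \<bullet> q)"
    "H y q q \<le> - \<eta> * E y * (4 * \<mu>\<^sup>2 * (d \<bullet> q)\<^sup>2 - 2 * \<mu> * (norm q)\<^sup>2)" if q: "q \<in> P" for q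
  proof -
    define e where "e t = - \<mu> * ((norm d)\<^sup>2 + 2 * t * (d \<bullet> q) + t\<^sup>2 * (norm q)\<^sup>2)" for t :: real
    define e' where "e' t = - \<mu> * (2 * (d \<bullet> q) + 2 * t * (norm q)\<^sup>2)" for t :: real
    have Ee: "E (y + t *\<^sub>R q) = exp (e t)" for t
    proof -
      have "(norm (y + t *\<^sub>R q - y1))\<^sup>2 = (norm (d + t *\<^sub>R q))\<^sup>2" by (simp add: d_def algebra_simps)
      also have "\<dots> = (norm d)\<^sup>2 + 2 * t * (d \<bullet> q) + t\<^sup>2 * (norm q)\<^sup>2"
        by (simp only: power2_norm_eq_inner) (simp add: algebra_simps inner_commute power2_eq_square)
      finally show ?thesis by (simp add: E_def e_def)
    qed
    have e: "(e has_real_derivative e' t) (at t)" for t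
      unfolding e_def e'_def by (auto intro!: derivative_eq_intros simp: algebra_simps)
    have e': "(e' has_real_derivative - \<mu> * 2 * (norm q)\<^sup>2) (at t)" for t
      unfolding e'_def by (auto intro!: derivative_eq_intros)
    define u where "u t = w (y + t *\<^sub>R q)" for t
    define u' where "u' t = dF (y + t *\<^sub>R q) q + \<eta> * (exp (e t) * e' t)" for t
    define s where "s = (\<delta> - dist z y) / (1 + norm q)"
    have s: "s > 0" using yint by (simp add: s_def add_pos_nonneg)
    have near: "y + t *\<^sub>R q \<in> cball z \<delta> \<inter> P" if t: "\<bar>t\<bar> < s" for t
    proof
      have "\<bar>t\<bar> * norm q \<le> \<bar>t\<bar> * (1 + norm q)" by (intro mult_left_mono) auto
      also have "\<dots> \<le> s * (1 + norm q)" using t by (intro mult_right_mono) auto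
      also have "\<dots> = \<delta> - dist z y" by (simp add: s_def add_nonneg_eq_0_iff)
      finally have "dist y (y + t *\<^sub>R q) \<le> \<delta> - dist z y" by (simp add: dist_norm)
      then show "y + t *\<^sub>R q \<in> cball z \<delta>" using dist_triangle[of z "y + t *\<^sub>R q" y] by simp
      show "y + t *\<^sub>R q \<in> P" using P yP q by (simp add: subspace_add subspace_scale)
    qed
    have "(u has_real_derivative u' t) (at t)" if "\<bar>t\<bar> < s" for t
    proof -
      have "((\<lambda>t. F (y + t *\<^sub>R q)) has_real_derivative dF (y + t *\<^sub>R q) q) (at t)"
        unfolding has_real_derivative_iff_has_vector_derivative
        by (rule has_derivative_along_line[OF dF]) (use near[OF that] cbz in auto)
      moreover have "((\<lambda>t. exp (e t) - exp (- \<mu> * \<rho>\<^sup>2)) has_real_derivative exp (e t) * e' t) (at t)"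
        by (auto intro!: derivative_eq_intros e)
      ultimately show ?thesis
        unfolding u_def u'_def w_def h_def Ee by (intro DERIV_add DERIV_cmult)
    qed
    moreover have "(u' has_real_derivative
        H y q q + \<eta> * (exp (e 0) * e' 0 * e' 0 + exp (e 0) * (- \<mu> * 2 * (norm q)\<^sup>2))) (at 0)"
    proof -
      have "((\<lambda>t. dF (y + t *\<^sub>R q) q) has_real_derivative H y q q) (at 0)"
        unfolding has_real_derivative_iff_has_vector_derivative
        by (rule has_derivative_along_line) (use HF[OF yball] in simp)
      moreover have "((\<lambda>t. exp (e t) * e' t) has_real_derivative
          exp (e 0) * e' 0 * e' 0 + exp (e 0) * (- \<mu> * 2 * (norm q)\<^sup>2)) (at 0)"
        by (auto intro!: derivative_eq_intros e e')
      ultimately show ?thesis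
        unfolding u'_def by (intro DERIV_add DERIV_cmult)
    qed
    moreover have "u t \<le> u 0" if "\<bar>t\<bar> < s" for t
      using y(2)[OF near[OF that]] by (simp add: u_def)
    ultimately have *: "u' 0 = 0"
      "H y q q + \<eta> * (exp (e 0) * e' 0 * e' 0 + exp (e 0) * (- \<mu> * 2 * (norm q)\<^sup>2)) \<le> 0"
      using second_derivative_nonpos_at_local_max[OF s] by blast+
    have E0: "exp (e 0) = E y" using Ee[of 0] by simp
    show "dF y q = 2 * \<mu> * \<eta> * E y * (d \<bullet> q)"
      using *(1) by (simp add: u'_def E0 e'_def)
    show "H y q q \<le> - \<eta> * E y * (4 * \<mu>\<^sup>2 * (d \<bullet> q)\<^sup>2 - 2 * \<mu> * (norm q)\<^sup>2)"
      using *(2) by (simp add: E0 e'_def algebra_simps power2_eq_square)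
  qed
  have "y \<in> ball x0 r \<inter> P" using yP yball by simp
  from ell[OF this] obtain Q where Q: "finite Q" "Q \<subseteq> P"
    "\<forall>v\<in>P. \<kappa> * (norm v)\<^sup>2 \<le> (\<Sum>q\<in>Q. (v \<bullet> q)\<^sup>2)"
    "(\<Sum>q\<in>Q. (norm q)\<^sup>2) \<le> K"
    "\<forall>b. (\<forall>v\<in>P. \<bar>dF y v\<bar> \<le> b * norm v) \<longrightarrow> \<bar>\<Sum>q\<in>Q. H y q q\<bar> \<le> K * b"
    by (elim exE conjE) (rule that)
  have "\<bar>dF y v\<bar> \<le> (2 * \<mu> * \<eta> * E y * norm d) * norm v" if "v \<in> P" for v
  proof -
    have "\<bar>dF y v\<bar> = 2 * \<mu> * \<eta> * E y * \<bar>d \<bullet> v\<bar>"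
      using second(1)[OF that] \<mu> \<eta>(1) E1(2)[of y] by (simp add: abs_mult)
    also have "\<dots> \<le> 2 * \<mu> * \<eta> * E y * (norm d * norm v)"
      using \<mu> \<eta>(1) E1(2)[of y] by (intro mult_left_mono Cauchy_Schwarz_ineq2) auto
    finally show ?thesis by (simp add: mult_ac)
  qed
  then have "\<bar>\<Sum>q\<in>Q. H y q q\<bar> \<le> K * (2 * \<mu> * \<eta> * E y * norm d)"
    by (intro Q(5)[rule_format]) simp
  moreover have "(\<Sum>q\<in>Q. H y q q)
      \<le> (\<Sum>q\<in>Q. - \<eta> * E y * (4 * \<mu>\<^sup>2 * (d \<bullet> q)\<^sup>2 - 2 * \<mu> * (norm q)\<^sup>2))"
    using second(2) Q(2) by (intro sum_mono) blast
  moreover have "(\<Sum>q\<in>Q. - \<eta> * E y * (4 * \<mu>\<^sup>2 * (d \<bullet> q)\<^sup>2 - 2 * \<mu> * (norm q)\<^sup>2))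
      = - (2 * \<mu> * \<eta> * E y) * (2 * \<mu> * (\<Sum>q\<in>Q. (d \<bullet> q)\<^sup>2) - (\<Sum>q\<in>Q. (norm q)\<^sup>2))"
    unfolding sum_distrib_left right_diff_distrib sum_subtractf
    by (simp add: algebra_simps power2_eq_square sum_negf)
  ultimately have "(2 * \<mu> * \<eta> * E y) * (2 * \<mu> * (\<Sum>q\<in>Q. (d \<bullet> q)\<^sup>2) - (\<Sum>q\<in>Q. (norm q)\<^sup>2))
      \<le> (2 * \<mu> * \<eta> * E y) * (K * norm d)"
    by (simp add: mult_ac)
  then have main: "2 * \<mu> * (\<Sum>q\<in>Q. (d \<bullet> q)\<^sup>2) - (\<Sum>q\<in>Q. (norm q)\<^sup>2) \<le> K * norm d"
    using \<mu> \<eta>(1) E1(2)[of y] by (simp add: mult_le_cancel_left_pos)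
  have "\<kappa> * (\<rho> / 2)\<^sup>2 \<le> \<kappa> * (norm d)\<^sup>2"
    using dn(1) \<rho> \<kappa> by (intro mult_left_mono power_mono) auto
  then have "\<kappa> * (\<rho> / 2)\<^sup>2 \<le> (\<Sum>q\<in>Q. (d \<bullet> q)\<^sup>2)" using bspec[OF Q(3) dP] by simp
  then have "2 * \<mu> * (\<kappa> * (\<rho> / 2)\<^sup>2) \<le> 2 * \<mu> * (\<Sum>q\<in>Q. (d \<bullet> q)\<^sup>2)"
    using \<mu> by (intro mult_left_mono) auto
  moreover have "2 * \<mu> * (\<kappa> * (\<rho> / 2)\<^sup>2) = K * (1 + 2 * \<rho>) + 1"
    using \<kappa> \<rho> by (simp add: \<mu>_def power_divide)
  moreover have "K * norm d \<le> K * (2 * \<rho>)" using dn(2) K by (intro mult_left_mono)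
  ultimately show False using main Q(4) by (simp add: algebra_simps)
qed

section \<open>The differential inequality in a slice\<close>

text \<open>
  Splitting \<open>v\<close> into tangential and normal part, the normal part drops out by the first cousin
  principle. Thus the numbers \<open>\<omega>(E[j := v]) / \<omega>(E)\<close> are the components of the orthogonal projection of \<open>v\<close>
  to the plane in the basis \<open>E\<close>.\<close>

lemma tangential_components:
  fixes g :: "'e::euclidean_space \<Rightarrow> 'e \<Rightarrow> real"
  assumes bil: "bilinear g" and sym: "\<And>v w. g v w = g w v" and pos: "\<And>v. v \<noteq> 0 \<Longrightarrow> g v v > 0"
    and alt: "alternating_form p \<omega>"
    and comass: "\<And>\<zeta>. unit_simple g p \<zeta> \<Longrightarrow> \<omega> \<zeta> \<le> 1"
    and \<xi>: "unit_simple g p \<xi>" "\<omega> \<xi> = 1" "span (set \<xi>) = span (set E)"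
    and E: "length E = p" "distinct E" "independent (set E)"
    and w: "w \<in> span (set E)"
  shows "(\<Sum>j<p. g w (E ! j) * \<omega> (E[j := v])) = \<omega> E * g w v"
proof -
  obtain Q where Q: "Q \<subseteq> span (set E)"
    and rep: "\<And>u. u \<in> span (set E) \<Longrightarrow> u = (\<Sum>q\<in>Q. g u q *\<^sub>R q)"
    using orthonormal_basis_exists[OF bil sym pos, of "set E"] by auto
  have lin: "linear (g u)" "linear (\<lambda>v. g v u)" for u using bil by (auto simp: bilinear_def)
  define T where "T = (\<Sum>q\<in>Q. g v q *\<^sub>R q)"
  define N where "N = v - T"
  have T: "T \<in> span (set E)" unfolding T_def using Q by (auto intro: span_sum span_scale)
  have N: "g N u = 0" if "u \<in> span (set E)" for u
  proof -
    have "g T u = (\<Sum>q\<in>Q. g v q * g q u)"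
      unfolding T_def by (simp add: linear_sum[OF lin(2)] linear_scale[OF lin(2)])
    moreover have "g v u = (\<Sum>q\<in>Q. g u q * g v q)"
      by (subst rep[OF that]) (simp add: linear_sum[OF lin(1)] linear_scale[OF lin(1)])
    ultimately show ?thesis by (simp add: N_def linear_diff[OF lin(2)] sym[of u] mult.commute)
  qed
  define L where "L v = (\<Sum>j<p. g w (E ! j) * \<omega> (E[j := v])) - \<omega> E * g w v" for v
  have linL: "linear L"
    unfolding L_def
    by (intro linear_compose_sub linear_compose_sum ballI)
      (use linear_compose[OF alternating_form_linear[OF alt E(1)] linear_times]
        linear_compose[OF lin(1)[of w] linear_times] in \<open>auto simp: o_def\<close>)
  have "L (E ! k) = 0" if k: "k < p" for k
  proof -
    have "\<omega> (E[j := E ! k]) = (if j = k then \<omega> E else 0)" if "j < p" for j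
      using alternating_form_repeat[OF alt, of "E[j := E ! k]" j k] that k E(1) by auto
    then have "(\<Sum>j<p. g w (E ! j) * \<omega> (E[j := E ! k]))
        = (\<Sum>j<p. if j = k then g w (E ! j) * \<omega> E else 0)"
      by (intro sum.cong) auto
    then show ?thesis using k by (simp add: L_def)
  qed
  then have "L u = 0" if "u \<in> set E" for u using that E(1) by (auto simp: in_set_conv_nth)
  then have "L T = 0" using linear_eq_0_on_span[OF linL _ T] by blast
  moreover have "L N = 0"
  proof -
    have "\<omega> (E[j := N]) = 0" if "j < p" for j
      by (rule calibration_zero_on_normal[OF bil sym alt comass \<xi>(1,2) E(1) _ E(2,3) that N])
        (use \<xi>(3) span_superset in auto)
    then show ?thesis using N[OF w] sym[of w N] by (simp add: L_def)
  qed
  moreover have "v = T + N" by (simp add: N_def)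
  ultimately have "L v = 0" using linear_add[OF linL, of T N] by simp
  then show ?thesis by (simp add: L_def)
qed

lemma common_bound_on_compact:
  fixes f :: "'i \<Rightarrow> 'a::topological_space \<Rightarrow> real"
  assumes "finite I" "compact K" "\<And>i. i \<in> I \<Longrightarrow> continuous_on K (f i)"
  shows "\<exists>M>0. \<forall>i\<in>I. \<forall>y\<in>K. \<bar>f i y\<bar> \<le> M"
proof -
  have "continuous_on K (\<lambda>y. \<Sum>i\<in>I. \<bar>f i y\<bar>)" using assms(3) by (intro continuous_intros)
  then have "bounded ((\<lambda>y. \<Sum>i\<in>I. \<bar>f i y\<bar>) ` K)"
    using assms(2) compact_continuous_image compact_imp_bounded by blast
  then obtain M where M: "M > 0" "\<And>y. y \<in> K \<Longrightarrow> \<bar>\<Sum>i\<in>I. \<bar>f i y\<bar>\<bar> \<le> M"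
    by (auto simp: bounded_pos)
  have "\<bar>f i y\<bar> \<le> M" if "i \<in> I" "y \<in> K" for i y
    using member_le_sum[of i I "\<lambda>i. \<bar>f i y\<bar>"] M(2)[OF that(2)] that assms(1) by auto
  then show ?thesis using M(1) by blast
qed

lemma line_eventually_in:
  fixes U P :: "'e::real_normed_vector set"
  assumes "open U" "y \<in> U" "subspace P" "y \<in> P" "v \<in> P"
  shows "\<forall>\<^sub>F t in nhds 0. y + t *\<^sub>R v \<in> U \<inter> P"
proof -
  have "((\<lambda>t. y + t *\<^sub>R v) \<longlongrightarrow> y + 0 *\<^sub>R v) (nhds 0)"
    by (intro tendsto_add tendsto_const tendsto_scaleR filterlim_ident)
  then have "\<forall>\<^sub>F t in nhds 0. y + t *\<^sub>R v \<in> U"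
    using topological_tendstoD[of "\<lambda>t. y + t *\<^sub>R v" y "nhds 0" U] assms by simp
  then show ?thesis
    by eventually_elim (use assms in \<open>simp add: subspace_add subspace_scale\<close>)
qed

text \<open>
  The data of the theorem in a slice chart: \<open>U\<close> is the image of the chart and \<open>U \<inter> P\<close> that of \<open>M\<close>,
  \<open>\<Phi>\<close>, \<open>\<gamma>\<close>, \<open>F\<close>, \<open>\<alpha>\<close>, \<open>\<sigma>\<close> are \<open>\<phi>\<close>, the metric, \<open>f\<close>, \<open>\<alpha>\<^sub>f\<close>, \<open>\<sigma>\<^sub>f\<close> in coordinates, and \<open>G\<close> is the
  Riemannian gradient of \<open>F\<close>. The list \<open>E\<close> is a constant frame of \<open>P\<close>, orthonormal for the inner product
  of the coordinate space and not for \<open>\<gamma>\<close>. With a constant frame all coefficients are finitely many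
  functions on \<open>U \<inter> P\<close> and are locally bounded by continuity.\<close>

locale calibrated_slice =
  fixes U P :: "'e::euclidean_space set" and p :: nat and E :: "'e list"
    and \<Phi> :: "'e \<Rightarrow> 'e list \<Rightarrow> real" and \<gamma> :: "'e \<Rightarrow> 'e \<Rightarrow> 'e \<Rightarrow> real"
    and F :: "'e \<Rightarrow> real" and G :: "'e \<Rightarrow> 'e" and \<alpha> \<sigma> :: "'e \<Rightarrow> 'e list \<Rightarrow> real"
  assumes U: "open U" and P: "subspace P" and p: "1 \<le> p"
    and E: "length E = p" "span (set E) = P" "\<And>i j. i < p \<Longrightarrow> j < p \<Longrightarrow> E ! i \<bullet> E ! j = (if i = j then 1 else 0)"
    and \<Phi>_alt: "\<And>y. y \<in> U \<Longrightarrow> alternating_form p (\<Phi> y)"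
    and \<Phi>_smooth: "\<And>vs. length vs = p \<Longrightarrow> smooth_on U (\<lambda>y. \<Phi> y vs)"
    and \<gamma>_bil: "\<And>y. y \<in> U \<Longrightarrow> bilinear (\<gamma> y)"
    and \<gamma>_sym: "\<And>y v w. y \<in> U \<Longrightarrow> \<gamma> y v w = \<gamma> y w v"
    and \<gamma>_pos: "\<And>y v. y \<in> U \<Longrightarrow> v \<noteq> 0 \<Longrightarrow> \<gamma> y v v > 0"
    and \<gamma>_smooth: "\<And>v w. smooth_on U (\<lambda>y. \<gamma> y v w)"
    and comass: "\<And>y \<xi>. y \<in> U \<Longrightarrow> unit_simple (\<gamma> y) p \<xi> \<Longrightarrow> \<Phi> y \<xi> \<le> 1"
    and calibrated: "\<And>y. y \<in> U \<inter> P \<Longrightarrow>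
      \<exists>\<xi>. unit_simple (\<gamma> y) p \<xi> \<and> set \<xi> \<subseteq> P \<and> \<Phi> y \<xi> = 1 \<and> \<sigma> y \<xi> = 0"
    and \<sigma>_alt: "\<And>y. y \<in> U \<Longrightarrow> alternating_form p (\<sigma> y)"
    and \<alpha>_cont: "\<And>vs. length vs = p - 1 \<Longrightarrow> continuous_on U (\<lambda>y. \<alpha> y vs)"
    and F_smooth: "smooth_on U F"
    and gradient: "\<And>y w. y \<in> U \<Longrightarrow> \<gamma> y (G y) w = frechet_derivative F (at y) w"
    and pluriharmonic: "\<And>y vs. y \<in> U \<Longrightarrow> length vs = p \<Longrightarrow>
      local_ext_deriv (\<lambda>z ws. \<Phi> z (G z # ws)) y vs
        = wedge1 (frechet_derivative F (at y)) (\<alpha> y) vs + \<sigma> y vs"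
begin

definition dF :: "'e \<Rightarrow> 'e \<Rightarrow> real" where
  "dF y = frechet_derivative F (at y)"

definition ddF :: "'e \<Rightarrow> 'e \<Rightarrow> 'e \<Rightarrow> real" where
  "ddF y v = frechet_derivative (\<lambda>z. dF z v) (at y)"

lemma dF: "y \<in> U \<Longrightarrow> (F has_derivative dF y) (at y)"
  unfolding dF_def by (rule smooth_on_has_derivative[OF F_smooth])

lemma ddF: "y \<in> U \<Longrightarrow> ((\<lambda>z. dF z v) has_derivative ddF y v) (at y)"
  unfolding dF_def ddF_def
  by (rule smooth_on_has_derivative[OF smooth_on_frechet_derivative[OF F_smooth]])

lemma E_in: "i < p \<Longrightarrow> E ! i \<in> P"
  using E(1,2) nth_mem span_base by metis

lemma E_distinct: "distinct E"
  unfolding distinct_conv_nth using E(1,3) by (metis zero_neq_one)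

lemma E_independent: "independent (set E)"
proof (rule pairwise_orthogonal_independent)
  show "pairwise orthogonal (set E)"
    unfolding pairwise_def orthogonal_def using E(1,3) by (metis in_set_conv_nth)
  show "0 \<notin> set E" using E(1,3) by (metis in_set_conv_nth inner_zero_left zero_neq_one)
qed

lemma E_expand:
  assumes "v \<in> P" shows "v = (\<Sum>l<p. (v \<bullet> E ! l) *\<^sub>R E ! l)"
proof -
  define L where "L v = v - (\<Sum>l<p. (v \<bullet> E ! l) *\<^sub>R E ! l)" for v
  have "linear L"
    by (rule linearI)
      (simp_all add: L_def inner_add_left scaleR_add_left sum.distrib scaleR_sum_right scaleR_diff_right)
  moreover have "L u = 0" if u: "u \<in> set E" for u
  proof -
    obtain k where k: "k < p" "u = E ! k" using u E(1) by (auto simp: in_set_conv_nth)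
    have "(\<Sum>l<p. (u \<bullet> E ! l) *\<^sub>R E ! l) = (\<Sum>l<p. if l = k then E ! l else 0)"
      unfolding k(2) by (rule sum.cong) (use E(3) k(1) in auto)
    then show ?thesis using k by (simp add: L_def)
  qed
  ultimately have "L v = 0" using linear_eq_0_on_span assms E(2) by blast
  then show ?thesis by (simp add: L_def)
qed

lemma plane:
  assumes "y \<in> U \<inter> P"
  obtains \<xi> where "unit_simple (\<gamma> y) p \<xi>" "\<Phi> y \<xi> = 1" "\<sigma> y \<xi> = 0" "span (set \<xi>) = span (set E)" "length \<xi> = p"
proof -
  obtain \<xi> where \<xi>: "unit_simple (\<gamma> y) p \<xi>" "set \<xi> \<subseteq> P" "\<Phi> y \<xi> = 1" "\<sigma> y \<xi> = 0"
    using calibrated[OF assms] by blast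
  have len: "length \<xi> = p" using \<xi>(1) by (simp add: unit_simple_def)
  have "dim P = p"
    using dim_eq_card_independent[OF E_independent] distinct_card[OF E_distinct] E(1,2) by (metis dim_span)
  then have "span (set \<xi>) = P"
    using alternating_form_nonzero_spans[OF \<Phi>_alt len _ P] \<xi> assms by auto
  then show ?thesis using that \<xi> len E(2) by blast
qed

text \<open>
  \<open>\<psi>\<close> is the density of the volume form of \<open>U \<inter> P\<close> with respect to the frame, up to sign, and on
  \<open>U \<inter> P\<close> the functions \<open>c j\<close> are the components of the gradient of the restriction of \<open>F\<close>. Defined by
  this quotient they make sense on a neighbourhood of \<open>U \<inter> P\<close> in \<open>U\<close>, so that they can be differentiated.\<close>

definition \<psi> where "\<psi> y = \<Phi> y E"

definition c where "c j y = \<Phi> y (E[j := G y]) / \<psi> y"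

lemma \<psi>_nonzero:
  assumes "y \<in> U \<inter> P" shows "\<psi> y \<noteq> 0"
proof
  assume *: "\<psi> y = 0"
  obtain \<xi> where \<xi>: "\<Phi> y \<xi> = 1" "span (set \<xi>) = span (set E)" "length \<xi> = p"
    using plane[OF assms] by metis
  have "\<Phi> y \<xi> = 0"
    by (rule alternating_form_zero_on_top[OF \<Phi>_alt E(1)])
      (use assms * \<xi> span_superset[of "set \<xi>"] in \<open>auto simp: \<psi>_def\<close>)
  then show False using \<xi> by simp
qed

lemma \<sigma>_zero: "y \<in> U \<inter> P \<Longrightarrow> \<sigma> y E = 0"
proof (rule plane)
  fix \<xi> assume y: "y \<in> U \<inter> P" and \<xi>: "\<sigma> y \<xi> = 0" "span (set \<xi>) = span (set E)" "length \<xi> = p"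
  show "\<sigma> y E = 0"
    by (rule alternating_form_zero_on_top[OF \<sigma>_alt \<xi>(3,1) E(1)])
      (use y \<xi> span_superset[of "set E"] in auto)
qed

lemma c_system:
  assumes y: "y \<in> U \<inter> P" and w: "w \<in> P"
  shows "(\<Sum>j<p. \<gamma> y w (E ! j) * c j y) = dF y w"
proof -
  have yU: "y \<in> U" using y by simp
  obtain \<xi> where \<xi>: "unit_simple (\<gamma> y) p \<xi>" "\<Phi> y \<xi> = 1" "span (set \<xi>) = span (set E)"
    using plane[OF y] by metis
  have "(\<Sum>j<p. \<gamma> y w (E ! j) * \<Phi> y (E[j := G y])) = \<Phi> y E * \<gamma> y w (G y)"
    using w unfolding E(2)[symmetric]
    by (intro tangential_components[OF \<gamma>_bil \<gamma>_sym \<gamma>_pos \<Phi>_alt comass \<xi> E(1) E_distinct E_independent] yU)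
  also have "\<gamma> y w (G y) = dF y w" using \<gamma>_sym[OF yU, of w] gradient[OF yU] by (simp add: dF_def)
  finally show ?thesis
    using \<psi>_nonzero[OF y] unfolding c_def times_divide_eq_right sum_divide_distrib[symmetric]
    by (simp add: \<psi>_def)
qed

lemma G_differentiable: "y \<in> U \<Longrightarrow> G differentiable (at y)"
  by (rule nondegenerate_system_solution_differentiable[OF U _ \<gamma>_bil \<gamma>_pos _ _ gradient])
    (auto intro: smooth_on_differentiable[OF \<gamma>_smooth] 
      smooth_on_differentiable[OF smooth_on_frechet_derivative[OF F_smooth]])

lemma W_differentiable:
  assumes y: "y \<in> U" and j: "j < p"
  shows "(\<lambda>z. \<Phi> z (E[j := G z])) differentiable (at y)"
proof -
  have "(\<lambda>z. \<Sum>b\<in>Basis. (G z \<bullet> b) * \<Phi> z (E[j := b])) differentiable (at y)"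
    by (intro differentiable_sum ballI finite_Basis differentiable_mult
        smooth_on_differentiable[OF \<Phi>_smooth y] differentiable_inner G_differentiable y)
      (use E(1) in auto)
  then obtain D where D: "((\<lambda>z. \<Sum>b\<in>Basis. (G z \<bullet> b) * \<Phi> z (E[j := b])) has_derivative D) (at y)"
    unfolding differentiable_def by blast
  have "((\<lambda>z. \<Phi> z (E[j := G z])) has_derivative D) (at y)"
  proof (rule has_derivative_transform_within_open[OF D U y])
    fix z assume z: "z \<in> U"
    have lin: "linear (\<lambda>v. \<Phi> z (E[j := v]))" by (rule alternating_form_linear[OF \<Phi>_alt[OF z] E(1) j])
    have "\<Phi> z (E[j := G z]) = \<Phi> z (E[j := \<Sum>b\<in>Basis. (G z \<bullet> b) *\<^sub>R b])"
      by (simp add: euclidean_representation)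
    then show "(\<Sum>b\<in>Basis. (G z \<bullet> b) * \<Phi> z (E[j := b])) = \<Phi> z (E[j := G z])"
      by (simp add: linear_sum[OF lin] linear_scale[OF lin])
  qed
  then show ?thesis unfolding differentiable_def by blast
qed

lemma \<psi>_derivative: "y \<in> U \<Longrightarrow> (\<psi> has_derivative frechet_derivative \<psi> (at y)) (at y)"
  unfolding \<psi>_def using smooth_on_has_derivative[OF \<Phi>_smooth[OF E(1)]] by simp

lemma c_derivative:
  assumes y: "y \<in> U \<inter> P" and j: "j < p"
  shows "(c j has_derivative frechet_derivative (c j) (at y)) (at y)"
proof -
  have "c j differentiable (at y)"
    unfolding c_def using \<psi>_nonzero[OF y] y j \<psi>_derivative[of y]
    by (intro differentiable_divide W_differentiable) (auto simp: differentiable_def)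
  then show ?thesis using frechet_derivative_works by blast
qed

text \<open>
  The two sides of \<open>c_system\<close> agree on the slice, so their derivatives agree in the directions
  \<open>E ! l\<close> tangent to it.\<close>

lemma c_system_derivative:
  assumes y: "y \<in> U \<inter> P" and k: "k < p" and l: "l < p"
  shows "ddF y (E ! k) (E ! l) =
    (\<Sum>j<p. \<gamma> y (E ! k) (E ! j) * frechet_derivative (c j) (at y) (E ! l)
      + frechet_derivative (\<lambda>z. \<gamma> z (E ! k) (E ! j)) (at y) (E ! l) * c j y)"
proof -
  have yU: "y \<in> U" and yP: "y \<in> P" using y by auto
  have lhs: "((\<lambda>z. \<Sum>j<p. \<gamma> z (E ! k) (E ! j) * c j z) has_derivative
      (\<lambda>w. \<Sum>j<p. \<gamma> y (E ! k) (E ! j) * frechet_derivative (c j) (at y) w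
      + frechet_derivative (\<lambda>z. \<gamma> z (E ! k) (E ! j)) (at y) w * c j y)) (at y)"
    by (intro has_derivative_sum has_derivative_mult c_derivative y
        smooth_on_has_derivative[OF \<gamma>_smooth yU]) auto
  have "\<forall>\<^sub>F t in nhds 0. (\<Sum>j<p. \<gamma> (y + t *\<^sub>R E ! l) (E ! k) (E ! j) * c j (y + t *\<^sub>R E ! l))
      = dF (y + t *\<^sub>R E ! l) (E ! k)"
    using line_eventually_in[OF U yU P yP E_in[OF l]]
    by eventually_elim (rule c_system[OF _ E_in[OF k]])
  from derivative_eq_along_line[OF lhs ddF[OF yU] this] show ?thesis by simp
qed

text \<open>
  The coefficients of \<open>(\<nabla>f \<lrcorner> \<phi>)|\<^sub>P\<close> are \<open>\<psi> c i\<close> up to sign, so its exterior derivative is the divergence of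
  \<open>\<psi> c\<close>; by pluriharmonicity it is of first order in \<open>F\<close>, as \<open>\<sigma>\<close> vanishes on the plane.\<close>

lemma divergence_equation:
  assumes y: "y \<in> U \<inter> P"
  shows "(\<Sum>i<p. \<psi> y * frechet_derivative (c i) (at y) (E ! i)
      + frechet_derivative \<psi> (at y) (E ! i) * c i y)
    = (\<Sum>i<p. (-1) ^ i * dF y (E ! i) * \<alpha> y (omit i E))"
proof -
  have yU: "y \<in> U" and yP: "y \<in> P" using y by auto
  have term_eq: "(-1) ^ i * frechet_derivative (\<lambda>z. \<Phi> z (G z # omit i E)) (at y) (E ! i)
      = \<psi> y * frechet_derivative (c i) (at y) (E ! i) + frechet_derivative \<psi> (at y) (E ! i) * c i y"
    if i: "i < p" for i
  proof -
    obtain D where D: "((\<lambda>z. \<Phi> z (E[i := G z])) has_derivative D) (at y)"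
      using W_differentiable[OF yU i] unfolding differentiable_def by blast
    have "((\<lambda>z. \<Phi> z (G z # omit i E)) has_derivative (\<lambda>h. (-1) ^ i * D h)) (at y)"
    proof (rule has_derivative_transform_within_open[OF has_derivative_mult_right[OF D, of "(-1) ^ i"] U yU])
      fix z assume z: "z \<in> U"
      show "(-1) ^ i * \<Phi> z (E[i := G z]) = \<Phi> z (G z # omit i E)"
        unfolding alternating_form_Cons_omit[OF \<Phi>_alt[OF z] E(1) i, symmetric]
        by (simp add: power_mult_distrib[symmetric] flip: mult.assoc)
    qed
    from frechet_derivative_at[OF this, symmetric]
    have "(-1) ^ i * frechet_derivative (\<lambda>z. \<Phi> z (G z # omit i E)) (at y) (E ! i) = D (E ! i)"
      by (simp add: power_mult_distrib[symmetric] flip: mult.assoc)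
    also have "\<dots> = \<psi> y * frechet_derivative (c i) (at y) (E ! i) + frechet_derivative \<psi> (at y) (E ! i) * c i y"
    proof (rule derivative_eq_along_line[OF D has_derivative_mult[OF \<psi>_derivative[OF yU] c_derivative[OF y i]]])
      show "\<forall>\<^sub>F t in nhds 0. \<Phi> (y + t *\<^sub>R E ! i) (E[i := G (y + t *\<^sub>R E ! i)])
          = \<psi> (y + t *\<^sub>R E ! i) * c i (y + t *\<^sub>R E ! i)"
        using line_eventually_in[OF U yU P yP E_in[OF i]]
        by eventually_elim (simp add: c_def \<psi>_nonzero)
    qed
    finally show ?thesis .
  qed
  have "local_ext_deriv (\<lambda>z ws. \<Phi> z (G z # ws)) y E
      = (\<Sum>i<p. \<psi> y * frechet_derivative (c i) (at y) (E ! i)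
        + frechet_derivative \<psi> (at y) (E ! i) * c i y)"
    unfolding local_ext_deriv_def E(1) by (rule sum.cong[OF refl]) (use term_eq in simp)
  then show ?thesis
    using pluriharmonic[OF yU E(1)] \<sigma>_zero[OF y] by (simp add: wedge1_def E(1) dF_def)
qed

end

lemma abs_sum_bound:
  fixes f :: "'i \<Rightarrow> real" and M :: real
  assumes "\<And>i. i \<in> I \<Longrightarrow> \<bar>f i\<bar> \<le> M"
  shows "\<bar>sum f I\<bar> \<le> card I * M"
  using sum_norm_bound[of I f M] assms by simp

lemma abs_sum_bound_lessThan:
  fixes f :: "nat \<Rightarrow> real" and M :: real
  assumes "\<And>i. i < n \<Longrightarrow> \<bar>f i\<bar> \<le> M"
  shows "\<bar>\<Sum>i<n. f i\<bar> \<le> n * M"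
  using abs_sum_bound[of "{..<n}" f M] assms by simp

context calibrated_slice
begin

lemma ddF_expand:
  assumes y: "y \<in> U" and v: "v \<in> P" and w: "w \<in> P"
  shows "ddF y v w = (\<Sum>k<p. \<Sum>l<p. (v \<bullet> E ! k) * (w \<bullet> E ! l) * ddF y (E ! k) (E ! l))"
proof -
  have "((\<lambda>z. \<Sum>k<p. (v \<bullet> E ! k) * dF z (E ! k)) has_derivative
      (\<lambda>h. \<Sum>k<p. (v \<bullet> E ! k) * ddF y (E ! k) h)) (at y)"
    by (intro has_derivative_sum has_derivative_mult_right ddF[OF y])
  then have "((\<lambda>z. dF z v) has_derivative (\<lambda>h. \<Sum>k<p. (v \<bullet> E ! k) * ddF y (E ! k) h)) (at y)"
  proof (rule has_derivative_transform_within_open[OF _ U y])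
    fix z assume z: "z \<in> U"
    have lin: "linear (dF z)" using dF[OF z] has_derivative_linear by blast
    show "(\<Sum>k<p. (v \<bullet> E ! k) * dF z (E ! k)) = dF z v"
      by (subst (2) E_expand[OF v]) (simp add: linear_sum[OF lin] linear_scale[OF lin])
  qed
  then have "ddF y v = (\<lambda>h. \<Sum>k<p. (v \<bullet> E ! k) * ddF y (E ! k) h)"
    using ddF[OF y] has_derivative_unique by blast
  moreover have "ddF y u w = (\<Sum>l<p. (w \<bullet> E ! l) * ddF y u (E ! l))" for u
  proof -
    have lin: "linear (ddF y u)" using ddF[OF y] has_derivative_linear by blast
    show ?thesis
      by (subst E_expand[OF w]) (simp add: linear_sum[OF lin] linear_scale[OF lin])
  qed
  ultimately show ?thesis by (simp add: sum_distrib_left mult_ac)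
qed

text \<open>
  The trace of the Hessian with respect to \<open>\<gamma>\<close> is the coordinate divergence of the gradient up to first order terms:
  in \<open>c_system_derivative\<close> the factor \<open>\<gamma> y (E ! k) (E ! j)\<close> is cancelled by the sum over the
  \<open>\<gamma>\<close>-orthonormal basis \<open>Q\<close>.\<close>

lemma hessian_trace:
  assumes y: "y \<in> U \<inter> P" and Q: "Q \<subseteq> P"
    and rep: "\<And>u. u \<in> P \<Longrightarrow> u = (\<Sum>q\<in>Q. \<gamma> y u q *\<^sub>R q)"
  shows "(\<Sum>q\<in>Q. ddF y q q) = (\<Sum>j<p. frechet_derivative (c j) (at y) (E ! j))
    + (\<Sum>q\<in>Q. \<Sum>k<p. \<Sum>l<p. (q \<bullet> E ! k) * (q \<bullet> E ! l) *
        (\<Sum>j<p. frechet_derivative (\<lambda>z. \<gamma> z (E ! k) (E ! j)) (at y) (E ! l) * c j y))"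
proof -
  have yU: "y \<in> U" using y by simp
  let ?D = "\<lambda>j l. frechet_derivative (c j) (at y) (E ! l)"
  let ?R = "\<lambda>q. \<Sum>k<p. \<Sum>l<p. (q \<bullet> E ! k) * (q \<bullet> E ! l) *
        (\<Sum>j<p. frechet_derivative (\<lambda>z. \<gamma> z (E ! k) (E ! j)) (at y) (E ! l) * c j y)"
  have lin: "linear (\<lambda>v. \<gamma> y v u)" for u using \<gamma>_bil[OF yU] by (simp add: bilinear_def)
  have q: "ddF y q q = (\<Sum>j<p. \<Sum>l<p. ?D j l * (\<gamma> y (E ! j) q * (q \<bullet> E ! l))) + ?R q" if "q \<in> Q" for q
  proof -
    have qP: "q \<in> P" using that Q by blast
    have \<gamma>q: "(\<Sum>k<p. (q \<bullet> E ! k) * \<gamma> y (E ! k) u) = \<gamma> y q u" for u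
      by (subst (2) E_expand[OF qP]) (simp add: linear_sum[OF lin] linear_scale[OF lin])
    have "ddF y q q = (\<Sum>k<p. \<Sum>l<p. (q \<bullet> E ! k) * (q \<bullet> E ! l) * (\<Sum>j<p. \<gamma> y (E ! k) (E ! j) * ?D j l)) + ?R q"
      unfolding ddF_expand[OF yU qP qP] sum.distrib[symmetric] distrib_left[symmetric]
      by (intro sum.cong refl arg_cong2[where f = "(*)"] c_system_derivative[OF y]) auto
    also have "(\<Sum>k<p. \<Sum>l<p. (q \<bullet> E ! k) * (q \<bullet> E ! l) * (\<Sum>j<p. \<gamma> y (E ! k) (E ! j) * ?D j l))
        = (\<Sum>j<p. \<Sum>l<p. \<Sum>k<p. (q \<bullet> E ! k) * (q \<bullet> E ! l) * (\<gamma> y (E ! k) (E ! j) * ?D j l))"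
      unfolding sum_distrib_left
      by (subst sum.swap, subst (2) sum.swap, subst sum.swap) (rule refl)
    also have "\<dots> = (\<Sum>j<p. \<Sum>l<p. ?D j l * (\<gamma> y (E ! j) q * (q \<bullet> E ! l)))"
    proof (intro sum.cong refl)
      fix j l
      have "(\<Sum>k<p. (q \<bullet> E ! k) * (q \<bullet> E ! l) * (\<gamma> y (E ! k) (E ! j) * ?D j l))
          = ?D j l * ((\<Sum>k<p. (q \<bullet> E ! k) * \<gamma> y (E ! k) (E ! j)) * (q \<bullet> E ! l))"
        by (simp add: sum_distrib_left sum_distrib_right mult_ac)
      then show "(\<Sum>k<p. (q \<bullet> E ! k) * (q \<bullet> E ! l) * (\<gamma> y (E ! k) (E ! j) * ?D j l))
          = ?D j l * (\<gamma> y (E ! j) q * (q \<bullet> E ! l))"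
        using \<gamma>q \<gamma>_sym[OF yU, of q "E ! j"] by simp
    qed
    finally show ?thesis .
  qed
  have "(\<Sum>q\<in>Q. \<Sum>j<p. \<Sum>l<p. ?D j l * (\<gamma> y (E ! j) q * (q \<bullet> E ! l))) = (\<Sum>j<p. ?D j j)"
  proof -
    have "(\<Sum>q\<in>Q. \<Sum>j<p. \<Sum>l<p. ?D j l * (\<gamma> y (E ! j) q * (q \<bullet> E ! l)))
        = (\<Sum>j<p. \<Sum>l<p. \<Sum>q\<in>Q. ?D j l * (\<gamma> y (E ! j) q * (q \<bullet> E ! l)))"
      by (subst sum.swap, subst (2) sum.swap) (rule refl)
    also have "\<dots> = (\<Sum>j<p. \<Sum>l<p. if l = j then ?D j l else 0)"
    proof (intro sum.cong refl)
      fix j l assume "j \<in> {..<p}" "l \<in> {..<p}"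
      then have jl: "j < p" "l < p" by auto
      have "(\<Sum>q\<in>Q. \<gamma> y (E ! j) q * (q \<bullet> E ! l)) = E ! j \<bullet> E ! l"
        by (subst (2) rep[OF E_in[OF jl(1)]]) (simp add: inner_sum_left)
      then show "(\<Sum>q\<in>Q. ?D j l * (\<gamma> y (E ! j) q * (q \<bullet> E ! l))) = (if l = j then ?D j l else 0)"
        using E(3)[OF jl] by (simp flip: sum_distrib_left)
    qed
    also have "\<dots> = (\<Sum>j<p. ?D j j)" by simp
    finally show ?thesis .
  qed
  then show ?thesis using q by (simp add: sum.distrib)
qed

text \<open>
  By \<open>hessian_trace\<close> and \<open>divergence_equation\<close> the trace is a linear expression in \<open>dF\<close> and \<open>c\<close>, and
  \<open>c\<close> is controlled by \<open>dF\<close> through \<open>c_system\<close>. The coefficients are continuous, so they are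
  bounded on a compact neighbourhood \<open>S\<close> of \<open>x0\<close> in \<open>P\<close>.\<close>

lemma elliptic_inequality:
  assumes x0: "x0 \<in> U \<inter> P"
  obtains r \<kappa> K where "r > 0" "\<kappa> > 0" "ball x0 r \<subseteq> U"
    "\<And>y. y \<in> ball x0 r \<inter> P \<Longrightarrow> \<exists>Q. finite Q \<and> Q \<subseteq> P \<and>
      (\<forall>v\<in>P. \<kappa> * (norm v)\<^sup>2 \<le> (\<Sum>q\<in>Q. (v \<bullet> q)\<^sup>2)) \<and> (\<Sum>q\<in>Q. (norm q)\<^sup>2) \<le> K \<and>
      (\<forall>b. (\<forall>v\<in>P. \<bar>dF y v\<bar> \<le> b * norm v) \<longrightarrow> \<bar>\<Sum>q\<in>Q. ddF y q q\<bar> \<le> K * b)"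
proof -
  obtain r where r: "r > 0" "cball x0 r \<subseteq> U"
    using U x0 by (metis IntD1 open_contains_cball)
  define S where "S = cball x0 r \<inter> P"
  have S: "compact S" unfolding S_def using closed_subspace[OF P] by (intro compact_Int_closed) auto
  have SU: "S \<subseteq> U" "S \<subseteq> U \<inter> P" using r by (auto simp: S_def)
  note cont = continuous_on_subset[OF smooth_on_continuous_on SU(1)]
  have \<gamma>S: "bilinear (\<gamma> z)" "v \<noteq> 0 \<Longrightarrow> \<gamma> z v v > 0" if "z \<in> S" for z v
    using that SU(1) \<gamma>_bil \<gamma>_pos by auto
  obtain \<kappa> L where \<kappa>L: "\<kappa> > 0" "L > 0" "\<And>z v. z \<in> S \<Longrightarrow> \<kappa> * (norm v)\<^sup>2 \<le> \<gamma> z v v"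
    "\<And>z v. z \<in> S \<Longrightarrow> \<gamma> z v v \<le> L * (norm v)\<^sup>2"
    by (rule uniform_ellipticity_on_compact[OF S \<gamma>S cont[OF \<gamma>_smooth]]) (assumption | rule that)+
  note \<kappa> = \<kappa>L(1,3) and L = \<kappa>L(2,4)
  define \<Gamma> where "\<Gamma> y k j l = frechet_derivative (\<lambda>z. \<gamma> z (E ! k) (E ! j)) (at y) (E ! l)" for y k j l
  define d\<psi> where "d\<psi> y i = frechet_derivative \<psi> (at y) (E ! i)" for y i
  have "\<exists>M>0. \<forall>kjl\<in>{..<p} \<times> {..<p} \<times> {..<p}. \<forall>y\<in>S. \<bar>\<Gamma> y (fst kjl) (fst (snd kjl)) (snd (snd kjl))\<bar> \<le> M"
    unfolding \<Gamma>_def by (intro common_bound_on_compact S cont smooth_on_frechet_derivative \<gamma>_smooth) auto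
  then obtain M1 where M1: "M1 > 0"
    "\<And>y k j l. y \<in> S \<Longrightarrow> k < p \<Longrightarrow> j < p \<Longrightarrow> l < p \<Longrightarrow> \<bar>\<Gamma> y k j l\<bar> \<le> M1" by fastforce
  have "\<exists>M>0. \<forall>i\<in>{..<p}. \<forall>y\<in>S. \<bar>d\<psi> y i\<bar> \<le> M"
    unfolding d\<psi>_def \<psi>_def
    by (intro common_bound_on_compact S cont smooth_on_frechet_derivative \<Phi>_smooth E) auto
  then obtain M2 where M2: "M2 > 0" "\<And>y i. y \<in> S \<Longrightarrow> i < p \<Longrightarrow> \<bar>d\<psi> y i\<bar> \<le> M2" by auto
  have "\<exists>M>0. \<forall>i\<in>{..<p}. \<forall>y\<in>S. \<bar>(-1) ^ i * \<alpha> y (omit i E)\<bar> \<le> M"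
    by (intro common_bound_on_compact S continuous_intros continuous_on_subset[OF \<alpha>_cont SU(1)])
      (auto simp: omit_def E(1))
  then obtain M3 where M3: "M3 > 0" "\<And>y i. y \<in> S \<Longrightarrow> i < p \<Longrightarrow> \<bar>\<alpha> y (omit i E)\<bar> \<le> M3"
    by (auto simp: abs_mult)
  have "\<exists>M>0. \<forall>i\<in>{()}. \<forall>y\<in>S. \<bar>1 / \<psi> y\<bar> \<le> M"
  proof (intro common_bound_on_compact S continuous_intros)
    show "continuous_on S \<psi>" unfolding \<psi>_def by (intro cont \<Phi>_smooth E)
    show "\<forall>y\<in>S. \<psi> y \<noteq> 0" using \<psi>_nonzero SU(2) by blast
  qed auto
  then obtain M4 where M4: "M4 > 0" "\<And>y. y \<in> S \<Longrightarrow> \<bar>1 / \<psi> y\<bar> \<le> M4" by auto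
  \<comment> \<open>up to the factor \<open>b\<close>, the two summands bound the two sums in \<open>hessian_trace\<close>, in reverse order\<close>
  define K1 where "K1 = DIM('e) * (p * (p * (1 / \<kappa> * (p * (M1 * (1 / \<kappa>))))))
    + M4 * (p * M3 + p * (M2 * (1 / \<kappa>)))"
  have K1: "K1 \<ge> 0" using M1(1) M2(1) M3(1) M4(1) \<kappa>(1) unfolding K1_def by (intro add_nonneg_nonneg mult_nonneg_nonneg) auto
  show ?thesis
  proof (rule that[of r "1 / L" "DIM('e) / \<kappa> + K1"])
    show "r > 0" "1 / L > 0" "ball x0 r \<subseteq> U" using r L(1) by auto
    fix y assume "y \<in> ball x0 r \<inter> P"
    then have yS: "y \<in> S" by (auto simp: S_def)
    then have y: "y \<in> U \<inter> P" and yU: "y \<in> U" using SU by auto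
    have lin1: "linear (\<lambda>v. \<gamma> y v u)" and lin2: "linear (\<gamma> y u)" for u
      using \<gamma>_bil[OF yU] by (auto simp: bilinear_def)
    have "\<exists>Q. finite Q \<and> Q \<subseteq> P \<and> (\<forall>q\<in>Q. \<forall>r\<in>Q. \<gamma> y q r = (if q = r then 1 else 0)) \<and>
        (\<forall>v\<in>P. v = (\<Sum>q\<in>Q. \<gamma> y v q *\<^sub>R q))"
      unfolding E(2)[symmetric]
      by (intro orthonormal_basis_exists \<gamma>_bil \<gamma>_sym \<gamma>_pos yU finite_set)
    then obtain Q where Q0: "finite Q" "Q \<subseteq> P" "\<forall>q\<in>Q. \<forall>r\<in>Q. \<gamma> y q r = (if q = r then 1 else 0)"
      and rep0: "\<forall>v\<in>P. v = (\<Sum>q\<in>Q. \<gamma> y v q *\<^sub>R q)"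
      by (elim exE conjE) (rule that)
    have Q: "finite Q" "Q \<subseteq> P" "\<And>q r. q \<in> Q \<Longrightarrow> r \<in> Q \<Longrightarrow> \<gamma> y q r = (if q = r then 1 else 0)"
      and rep: "\<And>v. v \<in> P \<Longrightarrow> v = (\<Sum>q\<in>Q. \<gamma> y v q *\<^sub>R q)"
      using Q0 bspec[OF rep0] by blast+
    have "independent Q"
    proof (rule ccontr)
      assume "\<not> independent Q"
      then obtain q where q: "q \<in> Q" "q \<in> span (Q - {q})" unfolding dependent_def by blast
      have "\<gamma> y q u = 0" if "u \<in> Q - {q}" for u using Q(3)[of q u] q(1) that by auto
      then have "\<gamma> y q q = 0" using linear_eq_0_on_span[OF lin2 _ q(2)] by blast
      then show False using Q(3)[OF q(1) q(1)] by simp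
    qed
    then have cardQ: "card Q \<le> DIM('e)" using independent_bound by blast
    have normq: "(norm q)\<^sup>2 \<le> 1 / \<kappa>" if "q \<in> Q" for q
      using \<kappa>(2)[OF yS, of q] Q(3)[OF that that] \<kappa>(1) by (simp add: field_simps)
    have i: "1 / L * (norm v)\<^sup>2 \<le> (\<Sum>q\<in>Q. (v \<bullet> q)\<^sup>2)" if v: "v \<in> P" for v
    proof (cases "v = 0")
      case False
      have "\<gamma> y v v = (\<Sum>q\<in>Q. (\<gamma> y v q)\<^sup>2)"
        by (subst (2) rep[OF v]) (simp add: linear_sum[OF lin2] linear_scale[OF lin2] power2_eq_square)
      then have S1: "(\<Sum>q\<in>Q. (\<gamma> y v q)\<^sup>2) \<le> L * (norm v)\<^sup>2" using L(2)[OF yS, of v] by simp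
      have "(norm v)\<^sup>2 = (\<Sum>q\<in>Q. \<gamma> y v q * (v \<bullet> q))"
        unfolding power2_norm_eq_inner by (subst (2) rep[OF v]) (simp add: inner_sum_right)
      then have "((norm v)\<^sup>2)\<^sup>2 \<le> (\<Sum>q\<in>Q. (\<gamma> y v q)\<^sup>2) * (\<Sum>q\<in>Q. (v \<bullet> q)\<^sup>2)"
        using Cauchy_Schwarz_ineq_sum[of "\<lambda>q. \<gamma> y v q" "\<lambda>q. v \<bullet> q" Q] by simp
      also have "\<dots> \<le> L * (norm v)\<^sup>2 * (\<Sum>q\<in>Q. (v \<bullet> q)\<^sup>2)"
        using S1 by (intro mult_right_mono sum_nonneg) auto
      finally have "(norm v)\<^sup>2 * (norm v)\<^sup>2 \<le> (norm v)\<^sup>2 * (L * (\<Sum>q\<in>Q. (v \<bullet> q)\<^sup>2))"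
        by (simp add: power2_eq_square mult_ac)
      then have "(norm v)\<^sup>2 \<le> L * (\<Sum>q\<in>Q. (v \<bullet> q)\<^sup>2)"
        by (rule mult_left_le_imp_le) (use False in simp)
      then show ?thesis using L(1) by (simp add: field_simps)
    qed (simp add: sum_nonneg)
    have "(\<Sum>q\<in>Q. (norm q)\<^sup>2) \<le> card Q * (1 / \<kappa>)" using normq by (intro sum_bounded_above)
    also have "\<dots> \<le> DIM('e) * (1 / \<kappa>)" using cardQ \<kappa>(1) by (intro mult_right_mono) auto
    finally have ii: "(\<Sum>q\<in>Q. (norm q)\<^sup>2) \<le> DIM('e) / \<kappa> + K1" using K1 by simp
    have iii: "\<bar>\<Sum>q\<in>Q. ddF y q q\<bar> \<le> (DIM('e) / \<kappa> + K1) * b"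
      if b: "\<forall>v\<in>P. \<bar>dF y v\<bar> \<le> b * norm v" for b
    proof -
      have normE: "norm (E ! i) = 1" if "i < p" for i using E(3)[OF that that] by (simp add: norm_eq_sqrt_inner)
      have dFE: "\<bar>dF y (E ! i)\<bar> \<le> b" if "i < p" for i
        using bspec[OF b E_in[OF that]] normE[OF that] by simp
      have b0: "0 \<le> b" using dFE[of 0] p by auto
      \<comment> \<open>\<open>T\<close> is the tangential gradient, so \<open>\<kappa> \<bar>T\<bar>\<^sup>2 \<le> \<gamma> y T T = dF y T \<le> b \<bar>T\<bar>\<close>\<close>
      define T where "T = (\<Sum>j<p. c j y *\<^sub>R E ! j)"
      have TP: "T \<in> P" unfolding T_def using P E_in by (auto intro!: subspace_sum subspace_scale)
      have "\<gamma> y T T = (\<Sum>j<p. \<gamma> y T (E ! j) * c j y)"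
        by (subst (2) T_def) (simp add: linear_sum[OF lin2] linear_scale[OF lin2] mult_ac)
      then have "\<gamma> y T T = dF y T" using c_system[OF y TP] by simp
      then have "\<kappa> * (norm T)\<^sup>2 \<le> b * norm T" using \<kappa>(2)[OF yS, of T] bspec[OF b TP] by simp
      then have "norm T * (\<kappa> * norm T) \<le> norm T * b" by (simp add: power2_eq_square mult_ac)
      then have "T \<noteq> 0 \<Longrightarrow> \<kappa> * norm T \<le> b" by simp
      then have normT: "norm T \<le> b * (1 / \<kappa>)" using \<kappa>(1) b0 by (cases "T = 0") (auto simp: field_simps)
      have cb: "\<bar>c j y\<bar> \<le> b * (1 / \<kappa>)" if j: "j < p" for j
      proof -
        have "T \<bullet> E ! j = (\<Sum>i<p. if i = j then c i y else 0)"
          unfolding T_def inner_sum_left by (rule sum.cong) (use E(3) j in auto)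
        then have "\<bar>c j y\<bar> = \<bar>T \<bullet> E ! j\<bar>" using j by simp
        also have "\<dots> \<le> norm T * norm (E ! j)" by (rule Cauchy_Schwarz_ineq2)
        finally show ?thesis using normT normE[OF j] by simp
      qed
      have "\<bar>\<Sum>q\<in>Q. \<Sum>k<p. \<Sum>l<p. (q \<bullet> E ! k) * (q \<bullet> E ! l) * (\<Sum>j<p. \<Gamma> y k j l * c j y)\<bar>
          \<le> card Q * (p * (p * (1 / \<kappa> * (p * (M1 * (b * (1 / \<kappa>)))))))"
      proof -
        have "\<bar>\<Sum>j<p. \<Gamma> y k j l * c j y\<bar> \<le> p * (M1 * (b * (1 / \<kappa>)))" if kl: "k < p" "l < p" for k l
        proof (rule abs_sum_bound_lessThan)
          fix j assume j: "j < p"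
          show "\<bar>\<Gamma> y k j l * c j y\<bar> \<le> M1 * (b * (1 / \<kappa>))"
            unfolding abs_mult using M1(2)[OF yS kl(1) j kl(2)] cb[OF j] M1(1) by (intro mult_mono) auto
        qed
        moreover have "\<bar>(q \<bullet> E ! k) * (q \<bullet> E ! l)\<bar> \<le> 1 / \<kappa>" if "q \<in> Q" "k < p" "l < p" for q k l
        proof -
          have "\<bar>q \<bullet> E ! i\<bar> \<le> norm q" if "i < p" for i
            using Cauchy_Schwarz_ineq2[of q "E ! i"] normE[OF that] by simp
          then have "\<bar>q \<bullet> E ! k\<bar> * \<bar>q \<bullet> E ! l\<bar> \<le> norm q * norm q"
            using that by (intro mult_mono) auto
          then show ?thesis using normq[OF that(1)] by (simp add: abs_mult power2_eq_square)
        qed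
        ultimately have t: "\<bar>(q \<bullet> E ! k) * (q \<bullet> E ! l) * (\<Sum>j<p. \<Gamma> y k j l * c j y)\<bar>
            \<le> 1 / \<kappa> * (p * (M1 * (b * (1 / \<kappa>))))" if "q \<in> Q" "k < p" "l < p" for q k l
          unfolding abs_mult[of "(q \<bullet> E ! k) * (q \<bullet> E ! l)"] using that \<kappa>(1) by (intro mult_mono) auto
        show ?thesis
          by (intro abs_sum_bound abs_sum_bound_lessThan t)
      qed
      also have "\<dots> \<le> DIM('e) * (p * (p * (1 / \<kappa> * (p * (M1 * (b * (1 / \<kappa>)))))))"
        using cardQ \<kappa>(1) M1(1) b0 by (intro mult_right_mono) auto
      finally have rem: "\<bar>\<Sum>q\<in>Q. \<Sum>k<p. \<Sum>l<p. (q \<bullet> E ! k) * (q \<bullet> E ! l) * (\<Sum>j<p. \<Gamma> y k j l * c j y)\<bar>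
          \<le> DIM('e) * (p * (p * (1 / \<kappa> * (p * (M1 * (b * (1 / \<kappa>)))))))" .
      have "\<psi> y * (\<Sum>i<p. frechet_derivative (c i) (at y) (E ! i))
          = (\<Sum>i<p. (-1) ^ i * dF y (E ! i) * \<alpha> y (omit i E)) - (\<Sum>i<p. d\<psi> y i * c i y)"
        using divergence_equation[OF y] by (simp add: sum.distrib sum_distrib_left d\<psi>_def)
      then have div: "(\<Sum>i<p. frechet_derivative (c i) (at y) (E ! i))
          = 1 / \<psi> y * ((\<Sum>i<p. (-1) ^ i * dF y (E ! i) * \<alpha> y (omit i E)) - (\<Sum>i<p. d\<psi> y i * c i y))"
        using \<psi>_nonzero[OF y] by (simp add: field_simps)
      have "\<bar>\<Sum>i<p. (-1) ^ i * dF y (E ! i) * \<alpha> y (omit i E)\<bar> \<le> p * (b * M3)"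
        by (intro abs_sum_bound_lessThan) (use dFE M3(2)[OF yS] b0 in \<open>auto simp: abs_mult intro!: mult_mono\<close>)
      moreover have "\<bar>\<Sum>i<p. d\<psi> y i * c i y\<bar> \<le> p * (M2 * (b * (1 / \<kappa>)))"
      proof (rule abs_sum_bound_lessThan)
        fix i assume i: "i < p"
        show "\<bar>d\<psi> y i * c i y\<bar> \<le> M2 * (b * (1 / \<kappa>))"
          unfolding abs_mult using M2(2)[OF yS i] cb[OF i] M2(1) by (intro mult_mono) auto
      qed
      ultimately have "\<bar>(\<Sum>i<p. (-1) ^ i * dF y (E ! i) * \<alpha> y (omit i E)) - (\<Sum>i<p. d\<psi> y i * c i y)\<bar>
          \<le> p * (b * M3) + p * (M2 * (b * (1 / \<kappa>)))" by linarith
      then have "\<bar>\<Sum>i<p. frechet_derivative (c i) (at y) (E ! i)\<bar> \<le> M4 * (p * (b * M3) + p * (M2 * (b * (1 / \<kappa>))))"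
        unfolding div abs_mult using M4(2)[OF yS] M4(1) by (intro mult_mono) auto
      moreover have "(\<Sum>q\<in>Q. ddF y q q) = (\<Sum>i<p. frechet_derivative (c i) (at y) (E ! i))
          + (\<Sum>q\<in>Q. \<Sum>k<p. \<Sum>l<p. (q \<bullet> E ! k) * (q \<bullet> E ! l) * (\<Sum>j<p. \<Gamma> y k j l * c j y))"
        using hessian_trace[OF y Q(2) rep] by (simp add: \<Gamma>_def)
      ultimately have "\<bar>\<Sum>q\<in>Q. ddF y q q\<bar> \<le> M4 * (p * (b * M3) + p * (M2 * (b * (1 / \<kappa>))))
          + DIM('e) * (p * (p * (1 / \<kappa> * (p * (M1 * (b * (1 / \<kappa>)))))))"
        using rem by linarith
      also have "\<dots> = K1 * b" by (simp add: K1_def algebra_simps)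
      also have "\<dots> \<le> (DIM('e) / \<kappa> + K1) * b" using \<kappa>(1) b0 by (intro mult_right_mono) auto
      finally show ?thesis .
    qed
    show "\<exists>Q. finite Q \<and> Q \<subseteq> P \<and>
      (\<forall>v\<in>P. 1 / L * (norm v)\<^sup>2 \<le> (\<Sum>q\<in>Q. (v \<bullet> q)\<^sup>2)) \<and> (\<Sum>q\<in>Q. (norm q)\<^sup>2) \<le> DIM('e) / \<kappa> + K1 \<and>
      (\<forall>b. (\<forall>v\<in>P. \<bar>dF y v\<bar> \<le> b * norm v) \<longrightarrow> \<bar>\<Sum>q\<in>Q. ddF y q q\<bar> \<le> (DIM('e) / \<kappa> + K1) * b)"
      using Q(1,2) i ii iii by blast
  qed
qed

end

context calibrated_slice
begin

text \<open>
  The differential inequality is the same for \<open>F\<close> and \<open>- F\<close>, so the maximum principle applies to both.\<close>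

lemma locally_constant_at_extremum:
  assumes x0: "x0 \<in> U \<inter> P" and s: "s > 0"
    and ext: "(\<forall>y\<in>ball x0 s \<inter> P. F y \<le> F x0) \<or> (\<forall>y\<in>ball x0 s \<inter> P. F x0 \<le> F y)"
  obtains t where "t > 0" "\<And>y. y \<in> ball x0 t \<inter> P \<Longrightarrow> F y = F x0"
proof -
  obtain r \<kappa> K where r: "r > 0" "\<kappa> > 0" "ball x0 r \<subseteq> U"
    and ell: "\<And>y. y \<in> ball x0 r \<inter> P \<Longrightarrow> \<exists>Q. finite Q \<and> Q \<subseteq> P \<and>
      (\<forall>v\<in>P. \<kappa> * (norm v)\<^sup>2 \<le> (\<Sum>q\<in>Q. (v \<bullet> q)\<^sup>2)) \<and> (\<Sum>q\<in>Q. (norm q)\<^sup>2) \<le> K \<and>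
      (\<forall>b. (\<forall>v\<in>P. \<bar>dF y v\<bar> \<le> b * norm v) \<longrightarrow> \<bar>\<Sum>q\<in>Q. ddF y q q\<bar> \<le> K * b)"
    by (rule elliptic_inequality[OF x0]) (assumption | rule that)+
  define r' where "r' = min r s"
  have r': "r' > 0" "ball x0 r' \<subseteq> ball x0 r" "ball x0 r' \<subseteq> ball x0 s" using r s by (auto simp: r'_def)
  have x0P: "x0 \<in> P" using x0 by simp
  have U': "y \<in> U" if "y \<in> ball x0 r'" for y using that r r' by blast
  have ell': "\<exists>Q. finite Q \<and> Q \<subseteq> P \<and>
      (\<forall>v\<in>P. \<kappa> * (norm v)\<^sup>2 \<le> (\<Sum>q\<in>Q. (v \<bullet> q)\<^sup>2)) \<and> (\<Sum>q\<in>Q. (norm q)\<^sup>2) \<le> K \<and>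
      (\<forall>b. (\<forall>v\<in>P. \<bar>dF y v\<bar> \<le> b * norm v) \<longrightarrow> \<bar>\<Sum>q\<in>Q. ddF y q q\<bar> \<le> K * b)"
    if "y \<in> ball x0 r' \<inter> P" for y using ell[of y] that r'(2) by blast
  have "F y = F x0" if y: "y \<in> ball x0 (r' / 2) \<inter> P" for y
    using ext
  proof
    assume "\<forall>y\<in>ball x0 s \<inter> P. F y \<le> F x0"
    then have m: "F y \<le> F x0" if "y \<in> ball x0 r' \<inter> P" for y using that r'(3) by blast
    show ?thesis
      by (rule strong_maximum_principle[OF P x0P r'(1) r(2) dF[OF U'] ddF[OF U'] ell' m y])
  next
    assume "\<forall>y\<in>ball x0 s \<inter> P. F x0 \<le> F y"
    then have m: "- F y \<le> - F x0" if "y \<in> ball x0 r' \<inter> P" for y using that r'(3) by auto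
    have "- F y = - F x0"
      by (rule strong_maximum_principle[OF P x0P r'(1) r(2) has_derivative_minus[OF dF[OF U']]
            has_derivative_minus[OF ddF[OF U']] _ m y])
        (use ell' in \<open>simp_all add: sum_negf\<close>)
    then show ?thesis by simp
  qed
  then show ?thesis using that[of "r' / 2"] r'(1) by simp
qed

end

section \<open>Passage to charts\<close>

text \<open>
  The two functions have the same derivatives at \<open>y\<close>, hence the same choice of a derivative, even if
  there is none.\<close>

lemma frechet_derivative_cong_open:
  assumes "open U" "y \<in> U" "\<And>z. z \<in> U \<Longrightarrow> f z = g z"
  shows "frechet_derivative f (at y) = frechet_derivative g (at y)"
proof -
  have "(f has_derivative D) (at y) \<longleftrightarrow> (g has_derivative D) (at y)" for D
    using has_derivative_transform_within_open[of f D y UNIV U g]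
      has_derivative_transform_within_open[of g D y UNIV U f] assms by auto
  then show ?thesis by (simp add: frechet_derivative_def)
qed

lemma wedge1_map:
  "wedge1 \<theta> \<alpha> (map S vs) = wedge1 (\<lambda>v. \<theta> (S v)) (\<lambda>ws. \<alpha> (map S ws)) vs"
  unfolding wedge1_def by (simp add: omit_def take_map drop_map)

lemma unit_simple_map:
  "unit_simple g p (map S \<xi>) \<longleftrightarrow> unit_simple (\<lambda>v w. g (S v) (S w)) p \<xi>"
proof -
  have "gram_det g (map S \<xi>) = gram_det (\<lambda>v w. g (S v) (S w)) \<xi>"
    unfolding gram_det_def length_map
  proof (intro sum.cong refl arg_cong2[where f = "(*)"] prod.cong)
    fix \<pi> i assume "\<pi> \<in> {\<pi>. \<pi> permutes {..<length \<xi>}}" "i \<in> {..<length \<xi>}"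
    then have "i < length \<xi>" "\<pi> i < length \<xi>" using permutes_in_image[of \<pi>] by fastforce+
    then show "g (map S \<xi> ! i) (map S \<xi> ! \<pi> i) = g (S (\<xi> ! i)) (S (\<xi> ! \<pi> i))" by simp
  qed
  then show ?thesis by (simp add: unit_simple_def)
qed

lemma is_chartD:
  assumes "is_chart c"
  shows "open (chart_dom c)" "open (chart_cod c)"
    "x \<in> chart_dom c \<Longrightarrow> point c (coord c x) = x"
    "y \<in> chart_cod c \<Longrightarrow> coord c (point c y) = y"
    "y \<in> chart_cod c \<Longrightarrow> point c y \<in> chart_dom c"
    "continuous_on (chart_dom c) (coord c)" "continuous_on (chart_cod c) (point c)"
  using assms unfolding is_chart_def homeomorphism_def by auto

locale manifold_atlas =
  fixes A :: "('a::{t2_space, second_countable_topology}, 'e::euclidean_space) chart set"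
  assumes manifold: "smooth_manifold A"
begin

lemma chart: "c \<in> A \<Longrightarrow> is_chart c"
  using manifold by (simp add: smooth_manifold_def)

lemma chart_at: "chart_at A x \<in> A" "x \<in> chart_dom (chart_at A x)"
proof -
  have "x \<in> (\<Union>c\<in>A. chart_dom c)" using manifold by (simp add: smooth_manifold_def)
  then have "\<exists>c. c \<in> A \<and> x \<in> chart_dom c" by blast
  from someI_ex[OF this] show "chart_at A x \<in> A" "x \<in> chart_dom (chart_at A x)"
    by (simp_all add: chart_at_def)
qed

lemma open_overlap:
  assumes c: "c \<in> A" and d: "d \<in> A"
  shows "open (coord c ` (chart_dom c \<inter> chart_dom d))"
proof -
  note cc = is_chartD[OF chart[OF c]]
  have "coord c ` (chart_dom c \<inter> chart_dom d) = chart_cod c \<inter> point c -` chart_dom d"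
    using cc(3,4,5) by force
  then show ?thesis
    using continuous_open_preimage[OF cc(7,2)] is_chartD(1)[OF chart[OF d]] by simp
qed

lemma transition_derivative:
  assumes "c \<in> A" "d \<in> A" "x \<in> chart_dom c" "x \<in> chart_dom d"
  shows "(transition c d has_derivative frechet_derivative (transition c d) (at (coord c x))) (at (coord c x))"
proof -
  have "compatible_charts c d" using manifold assms by (auto simp: smooth_manifold_def)
  then show ?thesis
    unfolding compatible_charts_def using assms by (blast intro: smooth_on_has_derivative)
qed

lemma transition_derivatives_inverse:
  assumes c: "c \<in> A" "x \<in> chart_dom c" and d: "d \<in> A" "x \<in> chart_dom d"
  shows "frechet_derivative (transition d c) (at (coord d x))
    (frechet_derivative (transition c d) (at (coord c x)) v) = v"
proof -
  note cc = is_chartD[OF chart[OF c(1)]] and dd = is_chartD[OF chart[OF d(1)]]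
  have x: "transition c d (coord c x) = coord d x" using cc(3)[OF c(2)] by (simp add: transition_def)
  have "(transition d c has_derivative frechet_derivative (transition d c) (at (coord d x)))
      (at (transition c d (coord c x)))"
    unfolding x using transition_derivative assms by blast
  from has_derivative_compose[OF transition_derivative[OF c(1) d(1) c(2) d(2)] this]
  have "((\<lambda>y. y) has_derivative (\<lambda>v. frechet_derivative (transition d c) (at (coord d x))
      (frechet_derivative (transition c d) (at (coord c x)) v))) (at (coord c x))"
  proof (rule has_derivative_transform_within_open[OF _ open_overlap[OF c(1) d(1)]])
    show "coord c x \<in> coord c ` (chart_dom c \<inter> chart_dom d)" using c d by blast
    fix y assume "y \<in> coord c ` (chart_dom c \<inter> chart_dom d)"
    then show "transition d c (transition c d y) = y"
      using cc(3) dd(3) by (auto simp: transition_def)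
  qed
  from has_derivative_unique[OF this has_derivative_ident] show ?thesis by metis
qed

lemma from_chart_in_chart:
  assumes "c \<in> A" "x \<in> chart_dom c"
  shows "from_chart A c x (in_chart A c x v) = v" "in_chart A c x (from_chart A c x v) = v"
  unfolding from_chart_def in_chart_def
  by (intro transition_derivatives_inverse assms chart_at)+

lemma linear_from_chart: "c \<in> A \<Longrightarrow> x \<in> chart_dom c \<Longrightarrow> linear (from_chart A c x)"
  unfolding from_chart_def using transition_derivative chart_at has_derivative_linear by blast

lemma linear_differential:
  assumes f: "smooth_function A f"
  shows "linear (differential A f x)"
proof -
  have "coord (chart_at A x) x \<in> chart_cod (chart_at A x)" using chart_at by blast
  then show ?thesis
    using f chart_at(1) smooth_on_has_derivative has_derivative_linear
    unfolding smooth_function_def differential_def by blast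
qed

text \<open>
  Chain rule for the passage from the distinguished chart at \<open>x\<close>, in which the differential is
  defined, to the chart \<open>c\<close>.\<close>

lemma derivative_in_chart:
  assumes f: "smooth_function A f" and c: "c \<in> A" "x \<in> chart_dom c"
  shows "frechet_derivative (f \<circ> point c) (at (coord c x)) w = differential A f x (from_chart A c x w)"
proof -
  define d where "d = chart_at A x"
  have d: "d \<in> A" "x \<in> chart_dom d" using chart_at by (auto simp: d_def)
  note cc = is_chartD[OF chart[OF c(1)]] and dd = is_chartD[OF chart[OF d(1)]]
  have x: "transition c d (coord c x) = coord d x" using cc(3)[OF c(2)] by (simp add: transition_def)
  have "smooth_on (chart_cod d) (f \<circ> point d)" using f d by (simp add: smooth_function_def)
  then have "((f \<circ> point d) has_derivative frechet_derivative (f \<circ> point d) (at (coord d x)))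
      (at (transition c d (coord c x)))"
    unfolding x using d by (intro smooth_on_has_derivative) auto
  from has_derivative_compose[OF transition_derivative[OF c(1) d(1) c(2) d(2)] this]
  have "((f \<circ> point c) has_derivative (\<lambda>w. frechet_derivative (f \<circ> point d) (at (coord d x))
      (frechet_derivative (transition c d) (at (coord c x)) w))) (at (coord c x))"
  proof (rule has_derivative_transform_within_open[OF _ open_overlap[OF c(1) d(1)]])
    show "coord c x \<in> coord c ` (chart_dom c \<inter> chart_dom d)" using c d by blast
    fix y assume "y \<in> coord c ` (chart_dom c \<inter> chart_dom d)"
    then show "(f \<circ> point d) (transition c d y) = (f \<circ> point c) y"
      using cc(3) dd(3) by (auto simp: transition_def)
  qed
  from frechet_derivative_at[OF this, symmetric] show ?thesis
    by (simp add: differential_def from_chart_def d_def)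
qed

lemma smooth_function_continuous:
  assumes f: "smooth_function A f"
  shows "continuous_on UNIV f"
proof -
  have "continuous_on (chart_dom c) f" if c: "c \<in> A" for c
  proof -
    note cc = is_chartD[OF chart[OF c]]
    have "continuous_on (chart_cod c) (f \<circ> point c)"
      using f c smooth_on_continuous_on unfolding smooth_function_def by blast
    then have "continuous_on (chart_dom c) (\<lambda>x. (f \<circ> point c) (coord c x))"
      by (rule continuous_on_compose2[OF _ cc(6)]) simp
    then show ?thesis by (rule continuous_on_eq) (simp add: cc(3))
  qed
  then have "continuous_on (\<Union>c\<in>A. chart_dom c) f"
    using is_chartD(1)[OF chart] by (intro continuous_on_open_UN)
  then show ?thesis using manifold by (simp add: smooth_manifold_def)
qed

text \<open>
  The gradient is a definite description: it exists by its components in a \<open>g\<close>-orthonormal basis and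
  is unique because \<open>g\<close> is positive definite.\<close>

lemma metric_gradient:
  assumes g: "riemannian_metric A g" and f: "smooth_function A f"
  shows "g x (gradient A g f x) w = differential A f x w"
proof -
  have bil: "bilinear (g x)" and sym: "\<And>v w. g x v w = g x w v" and pos: "\<And>v. v \<noteq> 0 \<Longrightarrow> g x v v > 0"
    using g by (auto simp: riemannian_metric_def)
  have lin: "linear (\<lambda>v. g x v w)" for w using bil by (simp add: bilinear_def)
  have linD: "linear (differential A f x)" by (rule linear_differential[OF f])
  obtain Q where Q: "\<forall>v\<in>span Basis. v = (\<Sum>q\<in>Q. g x v q *\<^sub>R q)"
    using orthonormal_basis_exists[of "g x" Basis] bil sym pos by auto
  define u where "u = (\<Sum>q\<in>Q. differential A f x q *\<^sub>R q)"
  have u: "g x u w = differential A f x w" for w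
  proof -
    have w: "w = (\<Sum>q\<in>Q. g x w q *\<^sub>R q)" using Q by (simp add: span_Basis)
    have "g x u w = (\<Sum>q\<in>Q. differential A f x q * g x q w)"
      unfolding u_def by (simp add: linear_sum[OF lin] linear_scale[OF lin])
    also have "\<dots> = differential A f x w"
      by (subst (2) w) (simp add: linear_sum[OF linD] linear_scale[OF linD] sym mult.commute)
    finally show ?thesis .
  qed
  have "v = u" if "\<forall>w. g x v w = differential A f x w" for v
  proof (rule ccontr)
    assume "v \<noteq> u"
    then have "g x (v - u) (v - u) > 0" using pos by simp
    then show False using that u bilinear_lsub[OF bil, of v u "v - u"] by simp
  qed
  then have "gradient A g f x = u" unfolding gradient_def using u by (intro the_equality) auto
  then show ?thesis using u by simp
qed

end

text \<open>
  \<open>S y\<close> and \<open>T y\<close> translate between components in the chart \<open>c\<close> and tangent vectors at \<open>point c y\<close>.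
  The calibrated plane at a point of \<open>M\<close> is the oriented tangent plane \<open>\<tau>\<close>; expressed in the chart it
  lies in \<open>P\<close> by the definition of the tangent space.\<close>

lemma calibrated_slice_of_chart:
  assumes X: "calibrated_manifold A \<nu> g p \<phi>" and M: "phi_submanifold A g p \<phi> M \<Gamma> \<tau>"
    and f: "pluriharmonic_mod_d A g p \<phi> f" and c: "slice_chart A p M c P"
  obtains E \<Phi> \<gamma> G \<alpha> \<sigma> where "calibrated_slice (chart_cod c) P p E \<Phi> \<gamma> (f \<circ> point c) G \<alpha> \<sigma>"
proof -
  have manifold: "smooth_manifold A" and g: "riemannian_metric A g" and p: "1 \<le> p"
    and \<phi>: "smooth_form A p \<phi>" and comass: "\<And>x \<xi>. unit_simple (g x) p \<xi> \<Longrightarrow> \<phi> x \<xi> \<le> 1"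
    using X by (auto simp: calibrated_manifold_def)
  interpret manifold_atlas A by unfold_locales (rule manifold)
  have cA: "c \<in> A" and P: "subspace P" "dim P = p"
    and slice: "coord c ` (chart_dom c \<inter> M) = chart_cod c \<inter> P"
    using c by (auto simp: slice_chart_def)
  note cc = is_chartD[OF chart[OF cA]]
  have fs: "smooth_function A f" using f by (simp add: pluriharmonic_mod_d_def)
  obtain \<alpha> \<sigma> where \<alpha>: "smooth_form A (p - 1) \<alpha>" and \<sigma>: "smooth_form A p \<sigma>"
    and \<sigma>0: "\<And>x \<xi>. \<xi> \<in> phi_planes g p \<phi> x \<Longrightarrow> \<sigma> x \<xi> = 0"
    and ext: "has_ext_deriv A (p - 1) (d_phi A g \<phi> f)
          (\<lambda>x vs. wedge1 (differential A f x) (\<alpha> x) vs + \<sigma> x vs)"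
    using f by (auto simp: pluriharmonic_mod_d_def)
  obtain B where B: "B \<subseteq> P" "pairwise orthogonal B" "\<And>x. x \<in> B \<Longrightarrow> norm x = 1"
    "independent B" "card B = dim P" "span B = P"
    using orthonormal_basis_subspace[OF P(1)] by metis
  obtain E where E: "set E = B" "distinct E"
    using finite_distinct_list[of B] B(4) finiteI_independent by blast
  define S where "S y = from_chart A c (point c y)" for y
  define T where "T y = in_chart A c (point c y)" for y
  define \<gamma> where "\<gamma> y v w = g (point c y) (S y v) (S y w)" for y v w
  define G where "G y = T y (gradient A g f (point c y))" for y
  have S: "linear (S y)" "S y (T y v) = v" "T y (S y v) = v" if "y \<in> chart_cod c" for y v
    using linear_from_chart[OF cA cc(5)[OF that]] from_chart_in_chart[OF cA cc(5)[OF that]]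
    by (auto simp: S_def T_def)
  have local_form: "local_form A c \<omega> y vs = \<omega> (point c y) (map (S y) vs)" for \<omega> :: "('a, 'b) dform" and y vs
    by (simp add: local_form_def S_def)
  have alt: "alternating_form k (local_form A c \<omega> y)" if "smooth_form A k \<omega>" "y \<in> chart_cod c" for k \<omega> y
    using alternating_form_pullback[OF _ S(1)[OF that(2)], of k "\<omega> (point c y)"] that(1)
    by (simp add: smooth_form_def local_form[abs_def])
  have dF: "frechet_derivative (f \<circ> point c) (at y) w = differential A f (point c y) (S y w)"
    if y: "y \<in> chart_cod c" for y w
    using derivative_in_chart[OF fs cA cc(5)[OF y], of w] by (simp add: cc(4)[OF y] S_def)
  have "calibrated_slice (chart_cod c) P p E (local_form A c \<phi>) \<gamma> (f \<circ> point c) G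
      (local_form A c \<alpha>) (local_form A c \<sigma>)"
  proof
    show "open (chart_cod c)" "subspace P" "1 \<le> p" "span (set E) = P"
      using cc(2) P p E B(6) by auto
    show len: "length E = p" using distinct_card[OF E(2)] E(1) B(5) P(2) by simp
    show "E ! i \<bullet> E ! j = (if i = j then 1 else 0)" if ij: "i < p" "j < p" for i j
    proof (cases "i = j")
      case True
      have "norm (E ! i) = 1" using B(3) E(1) ij(1) len nth_mem by blast
      then show ?thesis using True by (simp add: norm_eq_1)
    next
      case False
      then have "E ! i \<noteq> E ! j" using E(2) len ij by (simp add: nth_eq_iff_index_eq)
      then show ?thesis
        using B(2) E(1) ij len False nth_mem unfolding pairwise_def orthogonal_def by metis
    qed
    show "smooth_on (chart_cod c) (f \<circ> point c)" using fs cA by (simp add: smooth_function_def)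
    show "smooth_on (chart_cod c) (\<lambda>y. \<gamma> y v w)" for v w
      using g cA by (simp add: riemannian_metric_def \<gamma>_def S_def)
    show "smooth_on (chart_cod c) (\<lambda>y. local_form A c \<phi> y vs)" if "length vs = p" for vs
      using \<phi> cA that by (simp add: smooth_form_def)
    show "continuous_on (chart_cod c) (\<lambda>y. local_form A c \<alpha> y vs)" if "length vs = p - 1" for vs
      by (rule smooth_on_continuous_on) (use \<alpha> cA that in \<open>simp add: smooth_form_def\<close>)
    fix y
    show "\<exists>\<xi>. unit_simple (\<gamma> y) p \<xi> \<and> set \<xi> \<subseteq> P \<and> local_form A c \<phi> y \<xi> = 1 \<and> local_form A c \<sigma> y \<xi> = 0"
      if yP: "y \<in> chart_cod c \<inter> P"
    proof -
      have y: "y \<in> chart_cod c" using yP by simp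
      obtain x where x: "x \<in> chart_dom c" "x \<in> M" "y = coord c x" using yP slice by auto
      have px: "point c y = x" using x cc(3) by simp
      have plane: "\<tau> x \<in> phi_planes g p \<phi> x" and tangent: "set (\<tau> x) \<subseteq> tangent_subspace A p M x"
        using M x(2) by (auto simp: phi_submanifold_def submanifold_orientation_def)
      have ST: "map (S y) (map (T y) (\<tau> x)) = \<tau> x"
        by (simp add: map_idI S(2)[OF y])
      have "unit_simple (g x) p (map (S y) (map (T y) (\<tau> x)))"
        unfolding ST using plane by (simp add: phi_planes_def)
      then have "unit_simple (\<gamma> y) p (map (T y) (\<tau> x))"
        unfolding unit_simple_map \<gamma>_def[abs_def] px .
      moreover have "set (map (T y) (\<tau> x)) \<subseteq> P"
      proof -
        have "T y v \<in> P" if "v \<in> tangent_subspace A p M x" for v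
          using that x(1) c unfolding tangent_subspace_def T_def px by blast
        then show ?thesis using tangent by auto
      qed
      moreover have "local_form A c \<phi> y (map (T y) (\<tau> x)) = 1" "local_form A c \<sigma> y (map (T y) (\<tau> x)) = 0"
        unfolding local_form ST px using plane \<sigma>0[OF plane] by (auto simp: phi_planes_def)
      ultimately show ?thesis by blast
    qed
    assume y: "y \<in> chart_cod c"
    have gy: "bilinear (g (point c y))" "\<And>v w. g (point c y) v w = g (point c y) w v"
      "\<And>v. v \<noteq> 0 \<Longrightarrow> g (point c y) v v > 0"
      using g by (auto simp: riemannian_metric_def)
    show "alternating_form p (local_form A c \<phi> y)" "alternating_form p (local_form A c \<sigma> y)"
      using alt[OF \<phi> y] alt[OF \<sigma> y] .
    show "bilinear (\<gamma> y)"
    proof -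
      have "linear (\<lambda>w. g (point c y) v (S y w))" for v
        using linear_compose[OF S(1)[OF y], of "g (point c y) v"] gy(1) by (simp add: bilinear_def o_def)
      moreover have "linear (\<lambda>v. g (point c y) (S y v) w)" for w
        using linear_compose[OF S(1)[OF y], of "\<lambda>v. g (point c y) v w"] gy(1)
        by (simp add: bilinear_def o_def)
      ultimately show ?thesis by (simp add: bilinear_def \<gamma>_def)
    qed
    show "\<gamma> y v w = \<gamma> y w v" for v w using gy(2) by (simp add: \<gamma>_def)
    show "\<gamma> y v v > 0" if "v \<noteq> 0" for v
    proof -
      have "S y v \<noteq> 0"
        using that S(3)[OF y, of v] S(3)[OF y, of 0] linear_0[OF S(1)[OF y]] by metis
      then show ?thesis using gy(3) by (simp add: \<gamma>_def)
    qed
    show "local_form A c \<phi> y \<xi> \<le> 1" if "unit_simple (\<gamma> y) p \<xi>" for \<xi>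
      using comass[of "point c y" "map (S y) \<xi>"] that
      unfolding local_form unit_simple_map \<gamma>_def[abs_def] .
    show "\<gamma> y (G y) w = frechet_derivative (f \<circ> point c) (at y) w" for w
      unfolding \<gamma>_def G_def S(2)[OF y] dF[OF y] by (rule metric_gradient[OF g fs])
    show "local_ext_deriv (\<lambda>z ws. local_form A c \<phi> z (G z # ws)) y vs
        = wedge1 (frechet_derivative (f \<circ> point c) (at y)) (local_form A c \<alpha> y) vs + local_form A c \<sigma> y vs"
      if vs: "length vs = p" for vs
    proof -
      have "local_form A c (d_phi A g \<phi> f) z ws = local_form A c \<phi> z (G z # ws)"
        if "z \<in> chart_cod c" for z ws
        by (simp add: local_form d_phi_def contract_def G_def S(2)[OF that])
      then have "frechet_derivative (\<lambda>z. local_form A c (d_phi A g \<phi> f) z ws) (at y)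
          = frechet_derivative (\<lambda>z. local_form A c \<phi> z (G z # ws)) (at y)" for ws
        by (intro frechet_derivative_cong_open[OF cc(2) y])
      then have "local_ext_deriv (\<lambda>z ws. local_form A c \<phi> z (G z # ws)) y vs
          = local_ext_deriv (local_form A c (d_phi A g \<phi> f)) y vs"
        by (simp add: local_ext_deriv_def)
      also have "\<dots> = local_form A c (\<lambda>x vs. wedge1 (differential A f x) (\<alpha> x) vs + \<sigma> x vs) y vs"
      proof -
        have "length vs = Suc (p - 1)" using vs p by simp
        then show ?thesis by (rule ext[unfolded has_ext_deriv_def, rule_format, OF cA y, symmetric])
      qed
      also have "\<dots> = wedge1 (frechet_derivative (f \<circ> point c) (at y)) (local_form A c \<alpha> y) vs + local_form A c \<sigma> y vs"
        unfolding local_form[abs_def] wedge1_map dF[OF y, abs_def] by simp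
      finally show ?thesis .
    qed
  qed
  then show ?thesis by (rule that)
qed

section \<open>From local to global\<close>

text \<open>
  In the chart \<open>M\<close> is a convex set near \<open>x\<close>, hence connected and contained in the component \<open>C\<close>. So
  the point is a local extremum on \<open>M\<close>, not only on \<open>C\<close>.\<close>

lemma locally_constant_at_interior_extremum:
  assumes X: "calibrated_manifold A \<nu> g p \<phi>" and M: "phi_submanifold A g p \<phi> M \<Gamma> \<tau>"
    and f: "pluriharmonic_mod_d A g p \<phi> f"
    and C: "C \<in> components M" and x: "x \<in> C - \<Gamma>"
    and ext: "(\<forall>y\<in>C. f y \<le> f x) \<or> (\<forall>y\<in>C. f x \<le> f y)"
  shows "\<exists>V. open V \<and> x \<in> V \<and> (\<forall>y\<in>V \<inter> M. f y = f x)"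
proof -
  interpret manifold_atlas A
    using X by unfold_locales (simp add: calibrated_manifold_def)
  have xM: "x \<in> M - \<Gamma>" using x in_components_subset[OF C] by blast
  have "\<forall>x\<in>M - \<Gamma>. \<exists>c P. slice_chart A p M c P \<and> x \<in> chart_dom c"
    using M unfolding phi_submanifold_def submanifold_with_boundary_def by blast
  then obtain c P where c: "slice_chart A p M c P" and xc: "x \<in> chart_dom c"
    using xM by blast
  obtain E \<Phi> \<gamma> G \<alpha> \<sigma> where "calibrated_slice (chart_cod c) P p E \<Phi> \<gamma> (f \<circ> point c) G \<alpha> \<sigma>"
    using calibrated_slice_of_chart[OF X M f c] .
  then interpret calibrated_slice "chart_cod c" P p E \<Phi> \<gamma> "f \<circ> point c" G \<alpha> \<sigma> .
  have cA: "c \<in> A" and slice: "coord c ` (chart_dom c \<inter> M) = chart_cod c \<inter> P"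
    using c by (auto simp: slice_chart_def)
  note cc = is_chartD[OF chart[OF cA]]
  have x0: "coord c x \<in> chart_cod c \<inter> P" using xM xc slice by blast
  obtain s where s: "s > 0" "ball (coord c x) s \<subseteq> chart_cod c"
    using U x0 by (metis IntD1 open_contains_ball)
  define B where "B = ball (coord c x) s \<inter> P"
  have BM: "point c ` B \<subseteq> M"
  proof
    fix z assume "z \<in> point c ` B"
    then obtain y where y: "y \<in> B" "z = point c y" by blast
    then have "y \<in> coord c ` (chart_dom c \<inter> M)" unfolding slice using s(2) by (auto simp: B_def)
    then show "z \<in> M" using y(2) cc(3) by auto
  qed
  have "convex B" unfolding B_def using P by (intro convex_Int convex_ball subspace_imp_convex)
  then have "connected (point c ` B)"
    using s(2) by (intro connected_continuous_image convex_connected continuous_on_subset[OF cc(7)])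
      (auto simp: B_def)
  moreover have "x \<in> point c ` B" using x0 s(1) cc(3)[OF xc] by (force simp: B_def image_iff)
  ultimately have "point c ` B \<subseteq> C" using components_maximal[OF C _ BM] x by blast
  then have "(\<forall>y\<in>B. (f \<circ> point c) y \<le> (f \<circ> point c) (coord c x)) \<or>
      (\<forall>y\<in>B. (f \<circ> point c) (coord c x) \<le> (f \<circ> point c) y)"
    using ext cc(3)[OF xc] by auto
  then obtain t where t: "t > 0"
    "\<And>y. y \<in> ball (coord c x) t \<inter> P \<Longrightarrow> (f \<circ> point c) y = (f \<circ> point c) (coord c x)"
    using locally_constant_at_extremum[OF x0 s(1)] unfolding B_def by blast
  define V where "V = chart_dom c \<inter> coord c -` ball (coord c x) t"
  have "open V" unfolding V_def by (rule continuous_open_preimage[OF cc(6,1) open_ball])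
  moreover have "x \<in> V" using xc t(1) by (simp add: V_def)
  moreover have "f y = f x" if y: "y \<in> V \<inter> M" for y
  proof -
    have "coord c y \<in> chart_cod c \<inter> P" using y slice unfolding V_def by blast
    then show ?thesis using t(2)[of "coord c y"] y cc(3) xc by (auto simp: V_def)
  qed
  ultimately show ?thesis by blast
qed

text \<open>
  The set where the maximum over the component is attained is closed; where it misses \<open>\<Gamma>\<close> it is also
  open. So if it missed \<open>\<Gamma>\<close> altogether, it would be the whole component.\<close>

lemma component_maximum_on_boundary:
  fixes f :: "'a::t2_space \<Rightarrow> real"
  assumes M: "compact M" and f: "continuous_on M f" and C: "C \<in> components M" "C \<inter> \<Gamma> \<noteq> {}"
    and const: "\<And>x. x \<in> C - \<Gamma> \<Longrightarrow> \<forall>y\<in>C. f y \<le> f x \<Longrightarrow> \<exists>V. open V \<and> x \<in> V \<and> (\<forall>y\<in>V \<inter> M. f y = f x)"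
  shows "\<exists>z\<in>C \<inter> \<Gamma>. \<forall>y\<in>C. f y \<le> f z"
proof (rule ccontr)
  assume neg: "\<not> ?thesis"
  have CM: "C \<subseteq> M" by (rule in_components_subset[OF C(1)])
  have "compact C" using closedin_compact[OF M closedin_component[OF C(1)]] .
  moreover have "C \<noteq> {}" using C(2) by blast
  ultimately obtain z where z: "z \<in> C" "\<forall>y\<in>C. f y \<le> f z"
    using continuous_attains_sup continuous_on_subset[OF f CM] by blast
  define Z where "Z = {y \<in> C. f y = f z}"
  have "closedin (top_of_set C) Z"
    unfolding Z_def by (rule continuous_closedin_preimage_constant[OF continuous_on_subset[OF f CM]])
  moreover have "openin (top_of_set C) Z"
    unfolding openin_subopen[of _ Z]
  proof
    fix x assume x: "x \<in> Z"
    then have max: "\<forall>y\<in>C. f y \<le> f x" and xC: "x \<in> C" using z by (auto simp: Z_def)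
    then have "x \<in> C - \<Gamma>" using neg by blast
    from const[OF this max] obtain V where V: "open V" "x \<in> V" "\<forall>y\<in>V \<inter> M. f y = f x" by blast
    then have "C \<inter> V \<subseteq> Z" using CM x by (auto simp: Z_def)
    moreover have "openin (top_of_set C) (C \<inter> V)" using V(1) by (rule openin_open_Int)
    ultimately show "\<exists>T. openin (top_of_set C) T \<and> x \<in> T \<and> T \<subseteq> Z" using V(2) xC by blast
  qed
  moreover have "Z \<noteq> {}" using z by (auto simp: Z_def)
  ultimately have "Z = C" using in_components_connected[OF C(1)] unfolding connected_clopen by blast
  then have "\<forall>y\<in>C. \<forall>w\<in>C. f w \<le> f y" using z by (force simp: Z_def)
  then show False using neg C(2) by blast
qed

theorem corollary5p5:
  fixes A :: "('a::{t2_space, second_countable_topology}, 'e::euclidean_space) chart set"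
    and \<nu> :: "('a, 'e) dform"
    and g :: "'a \<Rightarrow> 'e \<Rightarrow> 'e \<Rightarrow> real"
    and p :: nat
    and \<phi> :: "('a, 'e) dform"
    and M \<Gamma> :: "'a set"
    and \<tau> :: "'a \<Rightarrow> 'e list"
    and f :: "'a \<Rightarrow> real"
    and x :: 'a
  assumes "calibrated_manifold A \<nu> g p \<phi>"
    and "phi_submanifold A g p \<phi> M \<Gamma> \<tau>"
    and "compact M"
    and "\<And>C. C \<in> components M \<Longrightarrow> C \<inter> \<Gamma> \<noteq> {}"
    and "pluriharmonic_mod_d A g p \<phi> f"
    and "x \<in> M"
  shows "(INF y\<in>\<Gamma>. f y) \<le> f x \<and> f x \<le> (SUP y\<in>\<Gamma>. f y)"
proof -
  interpret manifold_atlas A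
    using assms(1) by unfold_locales (simp add: calibrated_manifold_def)
  have "smooth_function A f" using assms(5) by (simp add: pluriharmonic_mod_d_def)
  then have f: "continuous_on M f"
    using smooth_function_continuous continuous_on_subset by blast
  have "\<Gamma> \<subseteq> M"
    using assms(2) by (auto simp: phi_submanifold_def submanifold_with_boundary_def manifold_boundary_def)
  moreover have "bounded (f ` M)"
    using assms(3) f compact_continuous_image compact_imp_bounded by blast
  ultimately have bdd: "bdd_above (f ` \<Gamma>)" "bdd_below (f ` \<Gamma>)"
    by (meson bounded_imp_bdd_above bounded_imp_bdd_below bounded_subset image_mono)+
  obtain C where C: "C \<in> components M" "x \<in> C"
    using assms(6) Union_components[of M] by blast
  note C\<Gamma> = assms(4)[OF C(1)]
  note const = locally_constant_at_interior_extremum[OF assms(1,2,5) C(1)]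
  have "\<exists>z\<in>C \<inter> \<Gamma>. \<forall>y\<in>C. f y \<le> f z"
    by (rule component_maximum_on_boundary[OF assms(3) f C(1) C\<Gamma>]) (use const in blast)
  then obtain z where "z \<in> \<Gamma>" "f x \<le> f z" using C(2) by blast
  then have "f x \<le> (SUP y\<in>\<Gamma>. f y)" using cSUP_upper2[OF bdd(1)] by blast
  moreover have "\<exists>z\<in>C \<inter> \<Gamma>. \<forall>y\<in>C. - f y \<le> - f z"
    by (rule component_maximum_on_boundary[OF assms(3) continuous_on_minus[OF f] C(1) C\<Gamma>]) (use const in auto)
  then obtain w where "w \<in> \<Gamma>" "f w \<le> f x" using C(2) by auto
  then have "(INF y\<in>\<Gamma>. f y) \<le> f x" using cINF_lower2[OF bdd(2)] by blast
  ultimately show ?thesis by blast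
qed

end
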